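(* Let $A=(a_{i,j})\in\Xi_{N,2r}$. The $\mathrm O_{2r}(q)$-orbit $\mathcal O_A\subseteq\mathcal X\times\mathcal X$ splits into two $\mathrm{SO}_{2r}(q)$-orbits if and only if $a_{n+1,n+1}=0$.
   Context: Let $n\ge1$, $r\ge2$, $N=2n+1$, and let $q$ be a power of an odd prime. On $\mathbb F_q^{2r}$ take the symmetric bilinear form $\langle x,y\rangle=\sum_{i=1}^{2r}x_iy_{2r+1-i}$; $\mathrm O_{2r}(q)$ is its isometry group and $\mathrm{SO}_{2r}(q)=\{g\in\mathrm O_{2r}(q):\det g=1\}$. $\mathcal X=\mathcal F^{\jmath}_{n,r}$ is the set of flags $F$: $0=F_0\subseteq F_1\subseteq\dots\subseteq F_N=\mathbb F_q^{2r}$ with $F_i\subseteq F_i^\perp$ and $F_{N-i}=F_i^\perp$ for $1\le i\le n$. $\mathrm O_{2r}(q)$ acts diagonally on $\mathcal X\times\mathcal X$. $\Xi_{N,2r}$ is the set of $N\times N$ matrices $A=(a_{i,j})$ over $\mathbb N$ with $a_{i,j}=a_{N+1-i,N+1-j}$ and $\sum a_{i,j}=2r$. For $(F,F')\in\mathcal X\times\mathcal X$ put $F_{i,j}=F_{i-1}+F_i\cap F'_j$ and $\mathfrak m(F,F')=(\dim F_{i,j}/F_{i,j-1})_{1\le i,j\le N}$; $\mathfrak m$ induces a bijection from $\mathrm O_{2r}(q)$-orbits on $\mathcal X\times\mathcal X$ to $\Xi_{N,2r}$, and $\mathcal O_A$ is the orbit $\{(F,F'):\mathfrak m(F,F')=A\}$.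 *)

theory Defs
  imports
    "HOL-Analysis.Analysis"
    "HOL-Library.Numeral_Type"
    "HOL-Library.Set_Algebras"
    "HOL-Computational_Algebra.Primes"
begin

text \<open>
  The space of column vectors of length \<open>2 * r\<close> over a finite field is
  \<open>'a ^ 'r bit0\<close> with \<open>r = CARD('r)\<close>: the index type \<open>'r bit0\<close> is the ring of
  integers modulo \<open>2 * r\<close>. The coordinates \<open>x\<^sub>1, \<dots>, x\<^sub>2\<^sub>r\<close> are \<open>x $ of_nat i\<close> for
  \<open>i = 1, \<dots>, 2 * r\<close>; by the following lemma each index occurs exactly once
  (the last one being \<open>of_nat (2 * r) = 0\<close>).
\<close>

lemma bij_betw_of_nat_bit0:
  "bij_betw (of_nat :: nat \<Rightarrow> 'r::finite bit0) {1..2 * CARD('r)} UNIV"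
proof -
  have surj: "\<exists>i\<in>{1..2 * CARD('r)}. x = of_nat i" for x :: "'r bit0"
  proof (cases x rule: bit0.cases)
    case (1 z)
    show ?thesis
    proof (cases "z = 0")
      case True
      have "(of_nat (CARD('r bit0)) :: 'r bit0) = 0"
        by (metis bit0.of_nat_eq Abs_bit0'_def bit0.Rep_0 bit0.zero_def mod_self of_nat_numeral)
      then show ?thesis using 1 True by (intro bexI[of _ "2 * CARD('r)"]) auto
    next
      case False
      then show ?thesis using 1 by (intro bexI[of _ "nat z"]) auto
    qed
  qed
  then have "of_nat ` {1..2 * CARD('r)} = (UNIV :: 'r bit0 set)"
    by auto
  moreover from this have "inj_on (of_nat :: nat \<Rightarrow> 'r bit0) {1..2 * CARD('r)}"
    by (intro eq_card_imp_inj_on) auto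
  ultimately show ?thesis by (simp add: bij_betw_def)
qed

definition bform :: "'a::field ^ 'r::finite bit0 \<Rightarrow> 'a ^ 'r bit0 \<Rightarrow> 'a" where
  "bform x y = (\<Sum>i = 1..2 * CARD('r). x $ of_nat i * y $ of_nat (2 * CARD('r) + 1 - i))"

definition perp :: "('a::field ^ 'r::finite bit0) set \<Rightarrow> ('a ^ 'r bit0) set" where
  "perp W = {x. \<forall>y\<in>W. bform x y = 0}"

definition orthogonal_group :: "('a::field ^ 'r::finite bit0 ^ 'r bit0) set" where
  "orthogonal_group = {g. invertible g \<and> (\<forall>x y. bform (g *v x) (g *v y) = bform x y)}"

definition special_orthogonal_group :: "('a::field ^ 'r::finite bit0 ^ 'r bit0) set" where
  "special_orthogonal_group = {g \<in> orthogonal_group. det g = 1}"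

text \<open>
  A flag is the list \<open>[F\<^sub>0, \<dots>, F\<^sub>N]\<close> with \<open>N = 2 * n + 1\<close>, so that \<open>F ! i\<close> is its
  \<open>i\<close>-th member.
\<close>

definition isotropic_flags :: "nat \<Rightarrow> ('a::field ^ 'r::finite bit0) set list set" where
  "isotropic_flags n = {F. let N = 2 * n + 1 in
     length F = N + 1 \<and>
     (\<forall>i\<le>N. vec.subspace (F ! i)) \<and>
     F ! 0 = {0} \<and> F ! N = UNIV \<and>
     (\<forall>i<N. F ! i \<subseteq> F ! (i + 1)) \<and>
     (\<forall>i\<in>{1..n}. F ! i \<subseteq> perp (F ! i) \<and> F ! (N - i) = perp (F ! i))}"

definition act_flag ::
  "'a::field ^ 'r::finite bit0 ^ 'r bit0 \<Rightarrow> ('a ^ 'r bit0) set list \<Rightarrow> ('a ^ 'r bit0) set list"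
where
  "act_flag g F = map (\<lambda>W. (*v) g ` W) F"

definition pair_orbit ::
  "('a::field ^ 'r::finite bit0 ^ 'r bit0) set
    \<Rightarrow> ('a ^ 'r bit0) set list \<times> ('a ^ 'r bit0) set list
    \<Rightarrow> (('a ^ 'r bit0) set list \<times> ('a ^ 'r bit0) set list) set"
where
  "pair_orbit G p = {(act_flag g (fst p), act_flag g (snd p)) | g. g \<in> G}"

definition pair_orbits ::
  "('a::field ^ 'r::finite bit0 ^ 'r bit0) set \<Rightarrow> nat
    \<Rightarrow> (('a ^ 'r bit0) set list \<times> ('a ^ 'r bit0) set list) set set"
where
  "pair_orbits G n = pair_orbit G ` (isotropic_flags n \<times> isotropic_flags n)"

text \<open>
  An \<open>N \<times> N\<close> matrix over the natural numbers is a function of two indices in \<open>{1..N}\<close>,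
  extended by \<open>0\<close> outside this range so that equality of functions is equality of matrices.
\<close>

definition Xi :: "nat \<Rightarrow> nat \<Rightarrow> (nat \<Rightarrow> nat \<Rightarrow> nat) set" where
  "Xi N d = {A.
     (\<forall>i j. i \<notin> {1..N} \<or> j \<notin> {1..N} \<longrightarrow> A i j = 0) \<and>
     (\<forall>i\<in>{1..N}. \<forall>j\<in>{1..N}. A i j = A (N + 1 - i) (N + 1 - j)) \<and>
     (\<Sum>i = 1..N. \<Sum>j = 1..N. A i j) = d}"

definition flag_meet ::
  "('a::field ^ 'r::finite bit0) set list \<Rightarrow> ('a ^ 'r bit0) set list
    \<Rightarrow> nat \<Rightarrow> nat \<Rightarrow> ('a ^ 'r bit0) set"
where
  "flag_meet F F' i j = F ! (i - 1) + (F ! i \<inter> F' ! j)"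

text \<open>
  The dimension of the quotient \<open>F\<^sub>i\<^sub>,\<^sub>j / F\<^sub>i\<^sub>,\<^sub>j\<^sub>-\<^sub>1\<close> is the difference of the dimensions; the
  subtraction does not truncate, since \<open>F\<^sub>i\<^sub>,\<^sub>j\<^sub>-\<^sub>1 \<subseteq> F\<^sub>i\<^sub>,\<^sub>j\<close> for flags.
\<close>

definition rel_pos ::
  "nat \<Rightarrow> ('a::field ^ 'r::finite bit0) set list \<Rightarrow> ('a ^ 'r bit0) set list
    \<Rightarrow> nat \<Rightarrow> nat \<Rightarrow> nat"
where
  "rel_pos N F F' = (\<lambda>i j. if i \<in> {1..N} \<and> j \<in> {1..N}
     then vec.dim (flag_meet F F' i j) - vec.dim (flag_meet F F' i (j - 1)) else 0)"

definition orbit_of_matrix ::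
  "nat \<Rightarrow> (nat \<Rightarrow> nat \<Rightarrow> nat)
    \<Rightarrow> (('a::field ^ 'r::finite bit0) set list \<times> ('a ^ 'r bit0) set list) set"
where
  "orbit_of_matrix n A =
     {(F, F'). F \<in> isotropic_flags n \<and> F' \<in> isotropic_flags n \<and> rel_pos (2 * n + 1) F F' = A}"

end

theory Submission
  imports Defs
begin

text \<open>
  For a pair \<open>(F, F')\<close> one builds hyperbolic pairs \<open>(e, f)\<close> one after the other, each adapted to
  both flags, until the members \<open>F\<^sub>n\<close> and \<open>F'\<^sub>n\<close> meet the orthogonal complement \<open>W\<close> of the
  chosen vectors trivially. The matrix \<open>A\<close> counts the positions of the chosen vectors in the two
  flags, and \<open>dim W = a\<^sub>n\<^sub>+\<^sub>1\<^sub>,\<^sub>n\<^sub>+\<^sub>1\<close>. Matching the hyperbolic pairs of two pairs of flags and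
  extending by Witt's theorem shows that the orthogonal group is transitive on \<open>O\<^sub>A\<close>, so everything
  depends on the determinants of the stabilizer of \<open>(F, F')\<close>.
  If \<open>W \<noteq> 0\<close>, then \<open>W\<close> contains an anisotropic vector, and its reflection stabilizes both flags.
  If \<open>W = 0\<close>, then \<open>F\<^sub>n + F\<^sub>n\<^sub>+\<^sub>1 \<inter> F'\<^sub>n\<close> is a maximal isotropic subspace preserved by the
  stabilizer, and isometries preserving such a subspace have determinant \<open>1\<close>.
\<close>

section \<open>The form, its isometries and reflections\<close>

text \<open>Incidence is measured by levels: the level of x in a flag is the index of the first
  member containing x. Since the complement of F_k is F_(2n+1-k), two vectors with nonzero product
  have levels adding up to at least 2n + 2, and a hyperbolic pair is adapted to a flag when equality
  holds. Equality is what makes the projection onto the chosen pairs preserve every member of the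
  flag. The complements W of two pairs of flags never have to be compared: the members up to index n
  are spanned by chosen vectors, and the remaining ones are orthogonal complements of those. A pair
  (e, f) may also be read as (f, e), so the matching is made on one position out of each two that
  are exchanged by the central symmetry of A. For a zero middle entry one must also know that
  \<open>orbit_of_matrix n A\<close> is nonempty. Flags spanned by coordinate vectors provide an
  element.\<close>

lemma of_nat_reverse_bit0:
  assumes "i \<in> {1..2 * CARD('r)}"
  shows "(of_nat (2 * CARD('r) + 1 - i) :: 'r::finite bit0) = 1 - of_nat i"
proof -
  have "(of_nat (2 * CARD('r)) :: 'r bit0) = 0"
    by (metis bit0.of_nat_eq Abs_bit0'_def bit0.zero_def card_bit0 mod_self of_nat_numeral
        of_nat_mult)
  then show ?thesis using assms by (simp add: of_nat_diff)
qed

text \<open>Modulo 2r the reversal of the coordinates is the involution taking i to 1 - i, so the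
  sum can run over the whole index type and be reindexed.\<close>

lemma bform_alt:
  fixes x y :: "'a::field ^ 'r::finite bit0"
  shows "bform x y = (\<Sum>i\<in>UNIV. x $ i * y $ (1 - i))"
proof -
  have "bform x y = (\<Sum>i = 1..2 * CARD('r). x $ of_nat i * y $ (1 - of_nat i))"
    unfolding bform_def by (intro sum.cong) (auto simp flip: of_nat_reverse_bit0)
  also have "\<dots> = (\<Sum>i\<in>UNIV. x $ i * y $ (1 - i))"
    by (rule sum.reindex_bij_betw[OF bij_betw_of_nat_bit0])
  finally show ?thesis .
qed

lemma bij_one_minus: "bij (\<lambda>i. 1 - i :: 'b::ring_1)"
  by (rule o_bij[where g = "\<lambda>i. 1 - i"]) auto

lemma bform_commute: "bform x y = bform y x"
proof -
  have "bform x y = (\<Sum>i\<in>UNIV. x $ (1 - i) * y $ (1 - (1 - i)))"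
    unfolding bform_alt by (rule sum.reindex_bij_betw[OF bij_one_minus, symmetric])
  then show ?thesis by (simp add: bform_alt mult.commute)
qed

lemma bform_simps [simp]:
  "bform (x + x') y = bform x y + bform x' y"
  "bform y (x + x') = bform y x + bform y x'"
  "bform (x - x') y = bform x y - bform x' y"
  "bform y (x - x') = bform y x - bform y x'"
  "bform (c *s x) y = c * bform x y"
  "bform y (c *s x) = c * bform y x"
  "bform (- x) y = - bform x y"
  "bform y (- x) = - bform y x"
  "bform 0 y = 0"
  "bform y 0 = 0"
  by (auto simp: bform_alt algebra_simps sum.distrib sum_subtractf sum_distrib_left sum_negf)

lemma bform_sum_left: "bform (sum f S) y = (\<Sum>s\<in>S. bform (f s) y)"
  by (induction S rule: infinite_finite_induct) auto

lemma bform_sum_right: "bform y (sum f S) = (\<Sum>s\<in>S. bform y (f s))"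
  by (induction S rule: infinite_finite_induct) auto

lemma bform_axis: "bform x (axis i 1) = x $ (1 - i)"
proof -
  have "bform x (axis i 1) = (\<Sum>j\<in>UNIV. if j = 1 - i then x $ j else 0)"
    unfolding bform_alt by (intro sum.cong) (auto simp: axis_def algebra_simps)
  then show ?thesis by simp
qed

lemma bform_nondegenerate: "(\<And>y. bform x y = 0) \<Longrightarrow> x = 0"
proof -
  assume "\<And>y. bform x y = 0"
  then have "x $ (1 - (1 - i)) = 0" for i using bform_axis[of x "1 - i"] by metis
  then show ?thesis by (simp add: vec_eq_iff)
qed

lemma subspace_perp: "vec.subspace (perp W)"
  by (auto simp: perp_def vec.subspace_def)

text \<open>For x outside W some linear functional vanishes on W but not at x. The form represents
  it by a vector y of \<open>perp W\<close>, so x is not orthogonal to all of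
  \<open>perp W\<close>.\<close>

lemma perp_perp:
  assumes W: "vec.subspace W"
  shows "perp (perp W) = W"
proof
  show "W \<subseteq> perp (perp W)" by (auto simp: perp_def bform_commute)
  show "perp (perp W) \<subseteq> W"
  proof (rule subsetI, rule ccontr)
    fix x assume x: "x \<in> perp (perp W)" "x \<notin> W"
    obtain B where B: "B \<subseteq> W" "vec.independent B" "W \<subseteq> vec.span B"
      by (rule vec.basis_exists[of W])
    then have sp: "vec.span B = W" using W by (simp add: vec.span_subspace)
    then have ind: "vec.independent (insert x B)"
      using B x by (intro vec.independent_insertI) auto
    \<comment> \<open>An arbitrary index: the functional is encoded as the k-th coordinate of an
      endomorphism T.\<close>
    obtain k :: "'b bit0" where True by simp
    obtain T where T: "Vector_Spaces.linear (*s) (*s) T"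
      "\<And>z. z \<in> insert x B \<Longrightarrow> T z = (if z = x then axis k 1 else 0 :: 'a ^ 'b bit0)"
      using vec.linear_independent_extend[OF ind, of "\<lambda>z. if z = x then axis k 1 else 0"] by blast
    interpret T: Vector_Spaces.linear "(*s)" "(*s)" T by (rule T(1))
    define y where "y = (\<chi> i. T (axis (1 - i) 1) $ k)"
    have y: "bform z y = T z $ k" for z
    proof -
      have "T z $ k = T (\<Sum>i\<in>UNIV. z $ i *s axis i 1) $ k"
        by (simp add: basis_expansion)
      also have "\<dots> = (\<Sum>i\<in>UNIV. z $ i * T (axis i 1) $ k)"
        by (simp add: T.sum T.scale)
      finally show ?thesis by (simp add: bform_alt y_def)
    qed
    have "x \<notin> B" using x B by auto
    then have "T b = 0" if "b \<in> B" for b using T(2)[of b] that by auto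
    then have "T z = 0" if "z \<in> W" for z
      using that sp T.eq_0_on_span[of B z] by auto
    then have "y \<in> perp W" by (simp add: perp_def y bform_commute[of y])
    then have "bform x y = 0" using x by (auto simp: perp_def)
    then show False using T(2)[of x] by (simp add: y)
  qed
qed

text \<open>Transposition along the antidiagonal. It is the adjoint for \<open>bform\<close> (see
  \<open>bform_adj\<close>), hence the inverse when g is an isometry.\<close>

definition adj :: "'a::field ^ 'r::finite bit0 ^ 'r bit0 \<Rightarrow> 'a ^ 'r bit0 ^ 'r bit0" where
  "adj g = (\<chi> i j. g $ (1 - j) $ (1 - i))"

lemma bform_adj: "bform (g *v x) y = bform x (adj g *v y)"
proof -
  have "bform (g *v x) y = (\<Sum>i\<in>UNIV. \<Sum>j\<in>UNIV. g $ i $ j * x $ j * y $ (1 - i))"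
    by (simp add: bform_alt matrix_vector_mult_def sum_distrib_right)
  also have "\<dots> = (\<Sum>j\<in>UNIV. \<Sum>i\<in>UNIV. g $ i $ j * x $ j * y $ (1 - i))"
    by (rule sum.swap)
  also have "\<dots> = (\<Sum>j\<in>UNIV. x $ j * (\<Sum>i\<in>UNIV. g $ i $ j * y $ (1 - i)))"
    by (simp add: sum_distrib_left algebra_simps)
  also have "\<dots> = (\<Sum>j\<in>UNIV. x $ j * (\<Sum>i\<in>UNIV. g $ (1 - i) $ j * y $ (1 - (1 - i))))"
    by (subst sum.reindex_bij_betw[OF bij_one_minus]) simp
  finally show ?thesis by (simp add: bform_alt matrix_vector_mult_def adj_def)
qed

lemma adj_unique:
  assumes "\<And>x y. bform (g *v x) y = bform x (h *v y)"
  shows "adj g = h"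
proof -
  have "bform x (adj g *v y - h *v y) = 0" for x y
    using assms[of x y] by (simp add: bform_adj)
  then have "adj g *v y = h *v y" for y
    using bform_nondegenerate[of "adj g *v y - h *v y"] by (simp add: bform_commute)
  then show ?thesis by (simp add: matrix_eq)
qed

text \<open>Reversing the rows and the columns of the transpose contributes the sign of the same
  permutation twice.\<close>

lemma det_adj: "det (adj g) = det (g :: 'a::field ^ 'r::finite bit0 ^ 'r bit0)"
proof -
  let ?p = "\<lambda>i. 1 - i :: 'r bit0"
  have p: "?p permutes UNIV" using bij_one_minus by (intro bij_imp_permutes) auto
  define h where "h = (\<chi> i. transpose g $ ?p i)"
  have "adj g = (\<chi> i j. h $ i $ ?p j)"
    by (simp add: adj_def h_def transpose_def vec_eq_iff)
  then have "det (adj g) = of_int (sign ?p) * (of_int (sign ?p) * det (transpose g))"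
    using det_permute_columns[OF p, of h] det_permute_rows[OF p, of "transpose g"]
    by (simp add: h_def)
  also have "\<dots> = of_int (sign ?p * sign ?p) * det g"
    by (simp only: of_int_mult mult.assoc det_transpose)
  also have "sign ?p * sign ?p = 1" by (simp add: sign_def)
  finally show ?thesis by simp
qed

lemma orthogonal_group_iff: "g \<in> orthogonal_group \<longleftrightarrow> adj g ** g = mat 1"
proof
  assume g: "g \<in> orthogonal_group"
  have "(adj g ** g) *v y = y" for y
  proof -
    have "bform ((adj g ** g) *v y - y) x = 0" for x
      using g bform_adj[of g x "g *v y"]
      by (simp add: orthogonal_group_def matrix_vector_mul_assoc bform_commute)
    then show ?thesis using bform_nondegenerate[of "(adj g ** g) *v y - y"] by simp
  qed
  then show "adj g ** g = mat 1" by (simp add: matrix_eq)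
next
  assume g: "adj g ** g = mat 1"
  then have "invertible g" using matrix_left_right_inverse invertible_def by blast
  then show "g \<in> orthogonal_group"
    using g by (simp add: orthogonal_group_def bform_adj matrix_vector_mul_assoc)
qed

lemma orthogonal_bform: "g \<in> orthogonal_group \<Longrightarrow> bform (g *v x) (g *v y) = bform x y"
  by (simp add: orthogonal_group_def)

lemma orthogonal_groupI:
  "(\<And>x y. bform (g *v x) (g *v y) = bform x y) \<Longrightarrow> g \<in> orthogonal_group"
  unfolding orthogonal_group_iff
proof -
  assume *: "\<And>x y. bform (g *v x) (g *v y) = bform x y"
  have "bform ((adj g ** g) *v y - y) x = 0" for x y
    using *[of x y] bform_adj[of g x "g *v y"]
    by (simp add: matrix_vector_mul_assoc bform_commute)
  then have "(adj g ** g) *v y = y" for y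
    using bform_nondegenerate[of "(adj g ** g) *v y - y"] by simp
  then show "adj g ** g = mat 1" by (simp add: matrix_eq)
qed

lemma orthogonal_adj:
  assumes "g \<in> orthogonal_group"
  shows "adj g ** g = mat 1" "g ** adj g = mat 1" "adj g \<in> orthogonal_group"
proof -
  show 1: "adj g ** g = mat 1" using assms by (simp add: orthogonal_group_iff)
  then show 2: "g ** adj g = mat 1" by (simp add: matrix_left_right_inverse)
  have "adj (adj g) = g" by (simp add: adj_def vec_eq_iff)
  with 2 show "adj g \<in> orthogonal_group" by (simp add: orthogonal_group_iff)
qed

lemma orthogonal_mult:
  "g \<in> orthogonal_group \<Longrightarrow> h \<in> orthogonal_group \<Longrightarrow> g ** h \<in> orthogonal_group"
  by (intro orthogonal_groupI) (simp add: orthogonal_bform flip: matrix_vector_mul_assoc)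

lemma orthogonal_one: "mat 1 \<in> orthogonal_group"
  by (intro orthogonal_groupI) simp

lemma orthogonal_det:
  assumes "g \<in> orthogonal_group"
  shows "det g = 1 \<or> det g = -1"
proof -
  have "det (adj g ** g) = 1" using assms by (simp add: orthogonal_adj)
  then have "(det g)\<^sup>2 = 1" by (simp add: det_mul det_adj power2_eq_square)
  then show ?thesis by (simp add: power2_eq_1_iff)
qed

section \<open>Reflections and Witt extension\<close>

definition reflection :: "'a::field ^ 'r::finite bit0 \<Rightarrow> 'a ^ 'r bit0 ^ 'r bit0" where
  "reflection v = matrix (\<lambda>x. x - (2 * bform x v / bform v v) *s v)"

lemma reflection_apply: "reflection v *v x = x - (2 * bform x v / bform v v) *s v"
proof -
  have "Vector_Spaces.linear (*s) (*s) (\<lambda>x. x - (2 * bform x v / bform v v) *s v)"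
    by unfold_locales
      (auto simp: algebra_simps add_divide_distrib vec.scale_left_distrib vec.scale_right_diff_distrib)
  then show ?thesis by (simp add: reflection_def matrix_works)
qed

lemma reflection_orthogonal:
  assumes "bform v v \<noteq> 0"
  shows "reflection v \<in> orthogonal_group"
proof (rule orthogonal_groupI)
  fix x y
  show "bform (reflection v *v x) (reflection v *v y) = bform x y"
    using assms by (simp add: reflection_apply bform_commute[of v x] bform_commute[of v y] field_simps)
qed

lemma reflection_fixes: "bform x v = 0 \<Longrightarrow> reflection v *v x = x"
  by (simp add: reflection_apply)

text \<open>In a basis made of v and a basis of \<open>perp {v}\<close> only v changes, and it
  changes sign. With this basis as rows of K, \<open>K ** transpose (reflection v)\<close> is K with
  one row negated.\<close>

lemma det_reflection:
  fixes v :: "'a::field ^ 'r::finite bit0"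
  assumes v: "bform v v \<noteq> 0"
  shows "det (reflection v) = -1"
proof -
  obtain C where C: "C \<subseteq> perp {v}" "vec.independent C" "perp {v} \<subseteq> vec.span C"
    by (rule vec.basis_exists[of "perp {v}"])
  have "vec.span C \<subseteq> perp {v}" using C(1) subspace_perp by (rule vec.span_minimal)
  then have "v \<notin> vec.span C" using v by (auto simp: perp_def)
  then have ind: "vec.independent (insert v C)"
    using C(2) by (rule vec.independent_insertI)
  have span: "vec.span (insert v C) = UNIV"
  proof -
    have "x \<in> vec.span (insert v C)" for x
    proof -
      have "bform (x - (bform x v / bform v v) *s v) v = 0" using v by simp
      then have "x - (bform x v / bform v v) *s v \<in> vec.span C" using C by (auto simp: perp_def)
      then show ?thesis by (auto simp: vec.span_insert)
    qed
    then show ?thesis by auto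
  qed
  have fin: "finite (insert v C)" using ind by (rule vec.finiteI_independent)
  have "card (insert v C) = vec.dim (vec.span (insert v C))"
    using ind by (rule vec.dim_span_eq_card_independent[symmetric])
  also have "\<dots> = CARD('r bit0)"
    unfolding span by (simp add: card_cart_basis)
  finally obtain b where b: "bij_betw b (UNIV :: 'r bit0 set) (insert v C)"
    using fin finite_same_card_bij[of "UNIV :: 'r bit0 set" "insert v C"] by auto
  then have "v \<in> range b" by (simp add: bij_betw_def)
  then obtain k where k: "b k = v" by auto
  have bC: "b j \<in> perp {v}" if "j \<noteq> k" for j
  proof -
    have "b j \<noteq> b k" using that b by (auto simp: bij_betw_def inj_on_def)
    moreover have "b j \<in> insert v C" using b by (auto simp: bij_betw_def)
    ultimately show ?thesis using C k by auto
  qed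
  define K where "K = (\<chi> j. b j)"
  have "rows K = insert v C"
    using b by (auto simp: rows_def row_def K_def bij_betw_def vec_lambda_eta)
  then obtain K' where "K' ** K = mat 1"
    using matrix_left_invertible_span_rows_gen[of K] span by auto
  then have detK: "det K \<noteq> 0" by (metis det_I det_mul mult_zero_right zero_neq_one)
  have "(K ** transpose (reflection v)) $ j = reflection v *v b j" for j
    by (simp add: vec_eq_iff matrix_matrix_mult_def matrix_vector_mult_def transpose_def K_def
        mult.commute)
  moreover have "reflection v *v b j = (if j = k then (- 1) *s b j else b j)" for j
  proof (cases "j = k")
    case True
    have "reflection v *v v = (- 1) *s v" using v by (simp add: reflection_apply vec_eq_iff)
    then show ?thesis using True k by simp
  next
    case False
    then show ?thesis using bC by (simp add: reflection_fixes perp_def)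
  qed
  ultimately have "K ** transpose (reflection v) = (\<chi> j. if j = k then (- 1) *s b j else b j)"
    by (simp add: vec_eq_iff)
  then have "det K * det (reflection v) = det (\<chi> j. if j = k then (- 1) *s b j else b j)"
    by (metis det_mul det_transpose)
  also have "\<dots> = - 1 * det (\<chi> j. if j = k then b j else b j)"
    by (rule det_row_mul)
  also have "(\<chi> j. if j = k then b j else b j) = K"
    by (simp add: K_def)
  finally have "det K * det (reflection v) = det K * (- 1)" by simp
  then show ?thesis using detK mult_left_cancel by blast
qed

text \<open>The norms of u - v and u + v add up to \<open>4 * bform u u\<close>, so they do not both
  vanish. If u - v is anisotropic, its reflection takes u to v. Otherwise the reflection in u + v
  takes u to -v, and the one in v corrects the sign.\<close>

lemma reflection_swap:
  fixes u v :: "'a::field ^ 'r::finite bit0"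
  assumes eq: "bform u u = bform v v" and nz: "bform u u \<noteq> 0" and two: "(2::'a) \<noteq> 0"
  shows "\<exists>g\<in>orthogonal_group. g *v u = v \<and> (\<forall>x. bform x u = 0 \<longrightarrow> bform x v = 0 \<longrightarrow> g *v x = x)"
proof (cases "bform (u - v) (u - v) = 0")
  case False
  define c where "c = bform u u - bform u v"
  have d: "bform (u - v) (u - v) = 2 * c" by (simp add: c_def eq bform_commute[of v u])
  then have "reflection (u - v) *v u = v" using False two
    by (simp add: reflection_apply flip: c_def)
  then show ?thesis using False
    by (intro bexI[of _ "reflection (u - v)"])
      (auto simp: reflection_fixes reflection_orthogonal simp del: bform_simps(3)
        intro!: reflection_fixes)
next
  case True
  have "bform (u + v) (u + v) + bform (u - v) (u - v) = 4 * bform u u"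
    by (simp add: eq)
  moreover have "(4::'a) = 2 * 2" by simp
  ultimately have nz': "bform (u + v) (u + v) \<noteq> 0" using True nz two
    by (metis add.right_neutral mult_eq_0_iff)
  define c where "c = bform u u + bform u v"
  have d: "bform (u + v) (u + v) = 2 * c" by (simp add: c_def eq bform_commute[of v u])
  have "reflection (u + v) *v u = - v" using nz' d two
    by (simp add: reflection_apply flip: c_def)
  moreover have "reflection v *v (- v) = v"
    using nz eq by (simp add: reflection_apply vec_eq_iff)
  ultimately have "(reflection v ** reflection (u + v)) *v u = v"
    by (simp flip: matrix_vector_mul_assoc)
  moreover have "(reflection v ** reflection (u + v)) *v x = x" if "bform x u = 0" "bform x v = 0" for x
    using that by (simp add: reflection_fixes flip: matrix_vector_mul_assoc)
  ultimately show ?thesis using nz' nz eq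
    by (intro bexI[of _ "reflection v ** reflection (u + v)"])
      (auto intro!: orthogonal_mult reflection_orthogonal simp del: bform_simps)
qed

text \<open>
  Witt's theorem for families of pairwise orthogonal anisotropic vectors: reflections move the
  vectors into place one after the other and fix those that are already in place.
\<close>

lemma witt_extension:
  fixes u v :: "'k \<Rightarrow> 'a::field ^ 'r::finite bit0"
  assumes "finite K" and two: "(2::'a) \<noteq> 0"
    and "\<And>i j. i \<in> K \<Longrightarrow> j \<in> K \<Longrightarrow> bform (u i) (u j) = bform (v i) (v j)"
    and "\<And>i j. i \<in> K \<Longrightarrow> j \<in> K \<Longrightarrow> bform (u i) (u j) = 0 \<longleftrightarrow> i \<noteq> j"
  shows "\<exists>g\<in>orthogonal_group. \<forall>i\<in>K. g *v u i = v i"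
  using assms(1,3,4)
proof (induction K rule: finite_induct)
  case empty
  then show ?case using orthogonal_one by auto
next
  case (insert k K)
  then obtain g where g: "g \<in> orthogonal_group" "\<forall>i\<in>K. g *v u i = v i" by auto
  have "bform (g *v u k) (g *v u k) = bform (v k) (v k)" "bform (g *v u k) (g *v u k) \<noteq> 0"
    using insert.prems(1,2)[of k k] g(1) by (auto simp: orthogonal_bform)
  then obtain h where h: "h \<in> orthogonal_group" "h *v (g *v u k) = v k"
      "\<And>x. bform x (g *v u k) = 0 \<Longrightarrow> bform x (v k) = 0 \<Longrightarrow> h *v x = x"
    using reflection_swap[OF _ _ two] by metis
  have "h *v (g *v u i) = v i" if i: "i \<in> K" for i
  proof -
    have "i \<noteq> k" using i insert.hyps by auto
    then have 0: "bform (u i) (u k) = 0" "bform (v i) (v k) = 0"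
      using insert.prems(1,2)[of i k] i by auto
    \<comment> \<open>Being \<open>g *v u i\<close>, the vector \<open>v i\<close> is orthogonal to
      \<open>g *v u k\<close> as well as to \<open>v k\<close>, so h fixes it.\<close>
    have "bform (v i) (g *v u k) = bform (g *v u i) (g *v u k)" using g i by simp
    then have "bform (v i) (g *v u k) = 0" using g 0 by (simp add: orthogonal_bform)
    then show ?thesis using h(3)[of "v i"] 0 g i by simp
  qed
  then show ?case using h g
    by (intro bexI[of _ "h ** g"]) (auto simp: orthogonal_mult simp flip: matrix_vector_mul_assoc)
qed

text \<open>
  With \<open>L\<close> the image of \<open>\<pi>\<close>, write \<open>g' = adj g\<close> for the inverse of \<open>g\<close> and \<open>a\<close> for the map that
  agrees with \<open>g\<close> on \<open>L\<close> and is the identity on the kernel of \<open>\<pi>\<close>. Then \<open>u = 1 + \<pi> - g \<pi> g'\<close>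
  satisfies \<open>u a = g (adj a)\<close>, and \<open>u\<close> is the square of an isometry since \<open>\<pi> - g \<pi> g'\<close> is
  skew and has square zero.
\<close>

lemma det_stabilizer_lagrangian:
  fixes g \<pi> :: "'a::field ^ 'r::finite bit0 ^ 'r bit0"
  assumes g: "g \<in> orthogonal_group" and two: "(2::'a) \<noteq> 0"
    and idem: "\<And>x. \<pi> *v (\<pi> *v x) = \<pi> *v x"
    and skew: "\<And>x y. bform (\<pi> *v x) y = bform x (y - \<pi> *v y)"
    and stab: "\<And>x. \<pi> *v (g *v (\<pi> *v x)) = g *v (\<pi> *v x)"
  shows "det g = 1"
proof -
  define g' where "g' = adj g"
  have inv [simp]: "g *v (g' *v x) = x" "g' *v (g *v x) = x" for x
    using orthogonal_adj[OF g] by (auto simp: g'_def matrix_vector_mul_assoc)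
  have bg: "bform (g *v x) y = bform x (g' *v y)" "bform (g' *v x) y = bform x (g *v y)" for x y
    using bform_adj[of g x y] bform_adj[of g y x] by (auto simp: g'_def bform_commute)
  note lin = matrix_vector_right_distrib matrix_vector_mult_diff_distrib vector_scalar_commute
  \<comment> \<open>The adjoint of \<pi> is 1 - \<pi>, so taking adjoints in (1 - \<pi>) g \<pi> = 0
    gives (1 - \<pi>) g' \<pi> = 0.\<close>
  have stab': "\<pi> *v (g' *v (\<pi> *v x)) = g' *v (\<pi> *v x)" for x
  proof -
    have "bform (g' *v (\<pi> *v x) - \<pi> *v (g' *v (\<pi> *v x))) y = 0" for y
    proof -
      have "bform (g' *v (\<pi> *v x) - \<pi> *v (g' *v (\<pi> *v x))) y
          = bform x (g *v (\<pi> *v y) - \<pi> *v (g *v (\<pi> *v y)))"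
        by (simp add: bg skew lin)
      then show ?thesis by (simp add: stab)
    qed
    then show ?thesis using bform_nondegenerate[of "g' *v (\<pi> *v x) - \<pi> *v (g' *v (\<pi> *v x))"] by simp
  qed
  note rules = idem stab stab' lin
  define N where "N = \<pi> - g ** \<pi> ** g'"
  have N: "N *v x = \<pi> *v x - g *v (\<pi> *v (g' *v x))" for x
    by (simp add: N_def matrix_vector_mult_diff_rdistrib matrix_vector_mul_assoc matrix_mul_assoc)
  \<comment> \<open>Both \<pi> and g \<pi> g' are projections onto L, and the image of N lies in
    L.\<close>
  have NN: "N *v (N *v x) = 0" for x by (simp add: N rules)
  have Nskew: "bform (N *v x) y = - bform x (N *v y)" for x y by (simp add: N bg skew lin)
  \<comment> \<open>The exponential of N / 2, cut off because N has square zero: a square root of 1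
    + N, and an isometry because N is skew. The determinant of its square is 1 whatever its own
    sign.\<close>
  define w where "w = matrix (\<lambda>x. x + (1 / 2) *s (N *v x))"
  have w: "w *v x = x + (1 / 2) *s (N *v x)" for x
  proof -
    have "Vector_Spaces.linear (*s) (*s) (\<lambda>x. x + (1 / 2) *s (N *v x))"
      by unfold_locales
        (auto simp: lin vec.scale_right_distrib vec.scale_left_distrib algebra_simps)
    then show ?thesis by (simp add: w_def matrix_works)
  qed
  have "w \<in> orthogonal_group"
    by (rule orthogonal_groupI) (simp add: w Nskew NN lin)
  moreover have "(w ** w) *v x = x + N *v x" for x
  proof -
    have "(w ** w) *v x = x + (1 / 2 + 1 / 2) *s (N *v x)"
      by (simp only: w NN lin vec.scale_left_distrib flip: matrix_vector_mul_assoc) simp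
    then show ?thesis using two by (simp add: field_simps)
  qed
  ultimately have detw: "det (w ** w) = 1" and ww: "\<And>x. (w ** w) *v x = x + N *v x"
    using orthogonal_det[of w] by (auto simp: det_mul)
  define a where "a = g ** \<pi> + mat 1 - \<pi>"
  define a' where "a' = g' - \<pi> ** g' + \<pi>"
  have a: "a *v x = g *v (\<pi> *v x) + x - \<pi> *v x" for x
    by (simp add: a_def matrix_vector_mult_diff_rdistrib matrix_vector_mult_add_rdistrib
        matrix_vector_mul_assoc)
  have a': "a' *v x = g' *v x - \<pi> *v (g' *v x) + \<pi> *v x" for x
    by (simp add: a'_def matrix_vector_mult_diff_rdistrib matrix_vector_mult_add_rdistrib
        matrix_vector_mul_assoc)
  have "adj a = a'"
    by (rule adj_unique) (simp add: a a' bg skew lin)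
  then have deta': "det a' = det a" using det_adj[of a] by simp
  have "((w ** w) ** a) *v x = (g ** a') *v x" for x
    unfolding matrix_vector_mul_assoc[of "w ** w" a x, symmetric] ww
      matrix_vector_mul_assoc[of g a' x, symmetric]
    by (simp add: a a' N rules)
  then have "(w ** w) ** a = g ** a'" by (simp add: matrix_eq)
  then have "det a = det g * det a" using detw deta' by (metis det_mul mult_1)
  \<comment> \<open>The inverse of a is g' on L and the identity on the kernel of \<pi>. So the
    determinant of a can be cancelled.\<close>
  moreover have "((g' ** \<pi> + mat 1 - \<pi>) ** a) *v x = x" for x
    by (simp add: a rules matrix_vector_mult_diff_rdistrib matrix_vector_mult_add_rdistrib
        flip: matrix_vector_mul_assoc)
  then have "(g' ** \<pi> + mat 1 - \<pi>) ** a = mat 1" by (simp add: matrix_eq)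
  then have "det a \<noteq> 0" by (metis det_I det_mul mult_zero_right zero_neq_one)
  ultimately show ?thesis by simp
qed

section \<open>Hyperbolic systems adapted to two flags\<close>

text \<open>Turns incidence with a flag into arithmetic: by \<open>mem_flag_iff\<close>, lying in
  \<open>F ! k\<close> means having level at most k.\<close>

definition lev :: "'b set list \<Rightarrow> 'b \<Rightarrow> nat" where
  "lev F x = (LEAST k. x \<in> F ! k)"

lemma flag_bounds:
  assumes "F \<in> isotropic_flags n"
  shows "length F = 2 * n + 2" "F ! 0 = {0}" "F ! (2 * n + 1) = UNIV"
  using assms by (auto simp: isotropic_flags_def Let_def)

lemma flag_subspace: "F \<in> isotropic_flags n \<Longrightarrow> k \<le> 2 * n + 1 \<Longrightarrow> vec.subspace (F ! k)"
  by (auto simp: isotropic_flags_def Let_def)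

lemma flag_mono:
  assumes F: "F \<in> isotropic_flags n" and "j \<le> k" "k \<le> 2 * n + 1"
  shows "F ! j \<subseteq> F ! k"
  using assms(2,3)
proof (induction k rule: dec_induct)
  case (step k)
  then have "F ! k \<subseteq> F ! Suc k" using F by (auto simp: isotropic_flags_def Let_def)
  then show ?case using step by auto
qed auto

text \<open>The definition of the flags covers the indices 1 to n. Index 0 is immediate from the two
  trivial members, and the upper half follows by taking complements twice.\<close>

lemma flag_perp:
  assumes F: "F \<in> isotropic_flags n" and k: "k \<le> 2 * n + 1"
  shows "perp (F ! k) = F ! (2 * n + 1 - k)"
proof -
  have low: "perp (F ! j) = F ! (2 * n + 1 - j)" if "j \<le> n" for j
  proof (cases "j = 0")
    case True
    then show ?thesis using flag_bounds[OF F] by (auto simp: perp_def)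
  next
    case False
    then show ?thesis using F that by (auto simp: isotropic_flags_def Let_def)
  qed
  show ?thesis
  proof (cases "k \<le> n")
    case False
    have "perp (F ! k) = perp (perp (F ! (2 * n + 1 - k)))"
      using False low[of "2 * n + 1 - k"] k by simp
    also have "\<dots> = F ! (2 * n + 1 - k)"
      using flag_subspace[OF F, of "2 * n + 1 - k"] by (intro perp_perp) simp
    finally show ?thesis .
  qed (rule low)
qed

lemma lev_le: "F \<in> isotropic_flags n \<Longrightarrow> lev F x \<le> 2 * n + 1"
  unfolding lev_def by (rule Least_le) (simp only: flag_bounds UNIV_I)

lemma mem_flag_iff:
  assumes F: "F \<in> isotropic_flags n" and k: "k \<le> 2 * n + 1"
  shows "x \<in> F ! k \<longleftrightarrow> lev F x \<le> k"
proof
  assume "x \<in> F ! k"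
  then show "lev F x \<le> k" unfolding lev_def by (rule Least_le)
next
  assume "lev F x \<le> k"
  moreover have "x \<in> F ! lev F x"
    unfolding lev_def by (rule LeastI[of _ "2 * n + 1"]) (simp only: flag_bounds(3)[OF F] UNIV_I)
  ultimately show "x \<in> F ! k" using flag_mono[OF F _ k] by auto
qed

text \<open>If the levels added up to at most 2n + 1, then y would lie in the complement of the
  member at the level of x.\<close>

lemma lev_add_ge:
  assumes F: "F \<in> isotropic_flags n" and "bform x y \<noteq> 0"
  shows "2 * n + 2 \<le> lev F x + lev F y"
proof (rule ccontr)
  assume *: "\<not> 2 * n + 2 \<le> lev F x + lev F y"
  then have "y \<in> F ! (2 * n + 1 - lev F x)" using mem_flag_iff[OF F] by simp
  then have "y \<in> perp (F ! lev F x)" using flag_perp[OF F lev_le[OF F]] by simp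
  moreover have "x \<in> F ! lev F x" using mem_flag_iff[OF F lev_le[OF F]] by simp
  ultimately show False using assms(2) by (auto simp: perp_def bform_commute)
qed

lemma lev_pos:
  assumes F: "F \<in> isotropic_flags n" and "x \<noteq> 0"
  shows "0 < lev F x"
  using mem_flag_iff[OF F, of 0 x] assms(2) flag_bounds[OF F] by auto

section \<open>Hyperbolic systems and the projection onto them\<close>

definition hyperbolic_system :: "(('a::field ^ 'r::finite bit0) \<times> ('a ^ 'r bit0)) set \<Rightarrow> bool" where
  "hyperbolic_system P \<longleftrightarrow> finite P \<and> (\<forall>p\<in>P. \<forall>q\<in>P. bform (fst p) (fst q) = 0 \<and>
     bform (snd p) (snd q) = 0 \<and> bform (fst p) (snd q) = (if p = q then 1 else 0))"

definition orth :: "(('a::field ^ 'r::finite bit0) \<times> ('a ^ 'r bit0)) set \<Rightarrow> ('a ^ 'r bit0) set" where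
  "orth P = perp (fst ` P \<union> snd ` P)"

text \<open>For a hyperbolic system this is the orthogonal projection onto the span of its
  vectors.\<close>

definition hyperbolic_proj ::
  "(('a::field ^ 'r::finite bit0) \<times> ('a ^ 'r bit0)) set \<Rightarrow> 'a ^ 'r bit0 \<Rightarrow> 'a ^ 'r bit0" where
  "hyperbolic_proj P x = (\<Sum>p\<in>P. bform x (snd p) *s fst p + bform x (fst p) *s snd p)"

text \<open>The case of equality in \<open>lev_add_ge\<close>: the two vectors of a pair lie as low
  in the flag as their product 1 permits.\<close>

definition compatible ::
  "nat \<Rightarrow> ('a::field ^ 'r::finite bit0) set list \<Rightarrow> (('a ^ 'r bit0) \<times> ('a ^ 'r bit0)) set \<Rightarrow> bool" where
  "compatible n F P \<longleftrightarrow> (\<forall>p\<in>P. lev F (fst p) + lev F (snd p) = 2 * n + 2)"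

lemma orth_iff: "x \<in> orth P \<longleftrightarrow> (\<forall>p\<in>P. bform x (fst p) = 0 \<and> bform x (snd p) = 0)"
  by (auto simp: orth_def perp_def)

lemma bform_hyperbolic_proj_orth: "y \<in> orth P \<Longrightarrow> bform y (hyperbolic_proj P x) = 0"
  unfolding hyperbolic_proj_def bform_sum_right by (intro sum.neutral) (simp add: orth_iff)

lemma bform_hyperbolic_proj:
  assumes P: "hyperbolic_system P" and p: "p \<in> P"
  shows "bform (hyperbolic_proj P x) (fst p) = bform x (fst p)"
    and "bform (hyperbolic_proj P x) (snd p) = bform x (snd p)"
proof -
  have fin: "finite P" using P by (simp add: hyperbolic_system_def)
  have "bform (hyperbolic_proj P x) (fst p) = (\<Sum>q\<in>P. if q = p then bform x (fst q) else 0)"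
    unfolding hyperbolic_proj_def bform_sum_left
    using P p by (intro sum.cong) (auto simp: hyperbolic_system_def bform_commute[of _ "fst p"])
  then show "bform (hyperbolic_proj P x) (fst p) = bform x (fst p)" using fin p by simp
  have "bform (hyperbolic_proj P x) (snd p) = (\<Sum>q\<in>P. if q = p then bform x (snd q) else 0)"
    unfolding hyperbolic_proj_def bform_sum_left
    using P p by (intro sum.cong) (auto simp: hyperbolic_system_def)
  then show "bform (hyperbolic_proj P x) (snd p) = bform x (snd p)" using fin p by simp
qed

lemma diff_hyperbolic_proj_orth:
  "hyperbolic_system P \<Longrightarrow> x - hyperbolic_proj P x \<in> orth P"
  by (simp add: orth_iff bform_hyperbolic_proj)

text \<open>If the coefficient of e, the product of x with its partner f, is nonzero, then
  \<open>lev_add_ge\<close> and the equality for (e, f) bound the level of e by that of x. So only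
  vectors inside \<open>F ! k\<close> contribute.\<close>

lemma hyperbolic_proj_in_span:
  assumes F: "F \<in> isotropic_flags n" and P: "compatible n F P" and x: "lev F x \<le> k"
    and k: "k \<le> 2 * n + 1"
  shows "hyperbolic_proj P x \<in> vec.span ((fst ` P \<union> snd ` P) \<inter> F ! k)"
  unfolding hyperbolic_proj_def
proof (rule vec.span_sum)
  fix p assume p: "p \<in> P"
  then have eq: "lev F (fst p) + lev F (snd p) = 2 * n + 2" using P by (auto simp: compatible_def)
  have "bform x (snd p) *s fst p \<in> vec.span ((fst ` P \<union> snd ` P) \<inter> F ! k)"
  proof (cases "bform x (snd p) = 0")
    case False
    then have "lev F (fst p) \<le> k" using lev_add_ge[OF F False] eq x by simp
    then have "fst p \<in> F ! k" using mem_flag_iff[OF F k] by simp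
    then show ?thesis using p by (intro vec.span_scale vec.span_base) auto
  qed (simp add: vec.span_zero)
  moreover have "bform x (fst p) *s snd p \<in> vec.span ((fst ` P \<union> snd ` P) \<inter> F ! k)"
  proof (cases "bform x (fst p) = 0")
    case False
    then have "lev F (snd p) \<le> k" using lev_add_ge[OF F False] eq x by simp
    then have "snd p \<in> F ! k" using mem_flag_iff[OF F k] by simp
    then show ?thesis using p by (intro vec.span_scale vec.span_base) auto
  qed (simp add: vec.span_zero)
  ultimately show "bform x (snd p) *s fst p + bform x (fst p) *s snd p
      \<in> vec.span ((fst ` P \<union> snd ` P) \<inter> F ! k)"
    by (rule vec.span_add)
qed

lemma hyperbolic_proj_in_flag:
  assumes F: "F \<in> isotropic_flags n" and P: "compatible n F P" and x: "x \<in> F ! k"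
    and k: "k \<le> 2 * n + 1"
  shows "hyperbolic_proj P x \<in> F ! k"
proof -
  have "vec.span ((fst ` P \<union> snd ` P) \<inter> F ! k) \<subseteq> F ! k"
    by (rule vec.span_minimal) (auto simp: flag_subspace[OF F k])
  then show ?thesis using hyperbolic_proj_in_span[OF F P _ k, of x] x mem_flag_iff[OF F k] by auto
qed

text \<open>The component of a vector of \<open>F ! k\<close> in \<open>orth P\<close> vanishes, so
  \<open>F ! k\<close> lies in the span of the pairs and is orthogonal to
  \<open>orth P\<close>.\<close>

lemma orth_subset_flag:
  assumes F: "F \<in> isotropic_flags n" and hyp: "hyperbolic_system P" and P: "compatible n F P"
    and k: "k \<le> 2 * n + 1" and triv: "F ! k \<inter> orth P \<subseteq> {0}"
  shows "orth P \<subseteq> F ! (2 * n + 1 - k)"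
proof
  fix x assume x: "x \<in> orth P"
  have "bform x y = 0" if y: "y \<in> F ! k" for y
  proof -
    have "y - hyperbolic_proj P y \<in> F ! k \<inter> orth P"
      using y hyperbolic_proj_in_flag[OF F P y k] diff_hyperbolic_proj_orth[OF hyp, of y]
        vec.subspace_diff[OF flag_subspace[OF F k]] by auto
    then have "y = hyperbolic_proj P y" using triv by auto
    then show ?thesis using bform_hyperbolic_proj_orth[OF x, of y] by simp
  qed
  then show "x \<in> F ! (2 * n + 1 - k)" using flag_perp[OF F k] by (auto simp: perp_def)
qed

lemma hyperbolic_system_insert:
  assumes P: "hyperbolic_system P" and "e \<in> orth P" "f \<in> orth P"
    and "bform e e = 0" "bform f f = 0" "bform e f = 1"
  shows "hyperbolic_system (insert (e, f) P)" "orth (insert (e, f) P) \<subset> orth P"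
proof -
  have "(e, f) \<notin> P" using assms by (auto simp: orth_iff)
  then show "hyperbolic_system (insert (e, f) P)" using assms
    by (auto simp: hyperbolic_system_def orth_iff bform_commute)
  have "e \<notin> orth (insert (e, f) P)" using assms by (simp add: orth_iff)
  moreover have "orth (insert (e, f) P) \<subseteq> orth P" by (auto simp: orth_iff)
  ultimately show "orth (insert (e, f) P) \<subset> orth P" using assms by auto
qed

text \<open>The vector e is taken as low as possible in F, and among such vectors as low as possible
  in F'. The partner f is then constructed for its level in F'; the level in F comes for
  free.\<close>

lemma hyperbolic_extension:
  fixes F F' :: "('a::field ^ 'r::finite bit0) set list"
  assumes F: "F \<in> isotropic_flags n" and F': "F' \<in> isotropic_flags n"
    and hyp: "hyperbolic_system P" and P: "compatible n F P" and P': "compatible n F' P"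
    and two: "(2::'a) \<noteq> 0" and ex: "\<not> F ! n \<inter> orth P \<subseteq> {0}"
  obtains e f where "e \<in> orth P" "f \<in> orth P" "bform e e = 0" "bform f f = 0" "bform e f = 1"
    "lev F e \<le> n" "lev F e + lev F f = 2 * n + 2" "lev F' e + lev F' f = 2 * n + 2"
proof -
  define Q where "Q k \<longleftrightarrow> (\<exists>x\<in>F ! k \<inter> orth P. x \<noteq> 0)" for k
  define i where "i = (LEAST k. Q k)"
  have "Q n" using ex by (auto simp: Q_def)
  then have Qi: "Q i" and i: "i \<le> n" unfolding i_def by (auto intro: LeastI Least_le)
  have Qmin: "i \<le> k" if "Q k" for k using that unfolding i_def by (rule Least_le)
  define R where "R k \<longleftrightarrow> (\<exists>x\<in>F ! i \<inter> F' ! k \<inter> orth P. x \<noteq> 0)" for k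
  define j where "j = (LEAST k. R k)"
  have "R (2 * n + 1)" using Qi flag_bounds(3)[OF F'] by (auto simp: R_def Q_def)
  then have Rj: "R j" and j: "j \<le> 2 * n + 1" unfolding j_def by (auto intro: LeastI Least_le)
  have Rmin: "j \<le> k" if "R k" for k using that unfolding j_def by (rule Least_le)
  obtain e where e: "e \<in> F ! i" "e \<in> F' ! j" "e \<in> orth P" "e \<noteq> 0" using Rj by (auto simp: R_def)
  have "e \<in> F ! lev F e" using mem_flag_iff[OF F lev_le[OF F]] by simp
  then have "Q (lev F e)" using e by (auto simp: Q_def)
  then have levF: "lev F e = i" using Qmin mem_flag_iff[OF F, of i e] e i by force
  have "e \<in> F' ! lev F' e" using mem_flag_iff[OF F' lev_le[OF F']] by simp
  then have "R (lev F' e)" using e by (auto simp: R_def)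
  then have levF': "lev F' e = j" using Rmin mem_flag_iff[OF F', of j e] e j by force
  have i0: "0 < i" and j0: "0 < j" using lev_pos[OF F e(4)] lev_pos[OF F' e(4)] levF levF' by auto
  \<comment> \<open>The complement of \<open>F' ! ?j'\<close> is \<open>F' ! (j - 1)\<close>, which
    misses e, so \<open>F' ! ?j'\<close> contains a vector with nonzero product with e.\<close>
  let ?j' = "2 * n + 2 - j"
  have "\<not> lev F' e \<le> j - 1" using levF' j0 by simp
  then have "e \<notin> F' ! (j - 1)" using mem_flag_iff[OF F', of "j - 1" e] j by simp
  moreover have "perp (F' ! ?j') = F' ! (j - 1)" using flag_perp[OF F', of ?j'] j j0 by simp
  ultimately obtain y where y: "y \<in> F' ! ?j'" "bform e y \<noteq> 0" by (auto simp: perp_def)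
  have j'N: "?j' \<le> 2 * n + 1" using j0 by simp
  note sub = flag_subspace[OF F' j'N]
  define z where "z = y - hyperbolic_proj P y"
  have z: "z \<in> F' ! ?j'" "z \<in> orth P" "bform e z \<noteq> 0"
    using y hyperbolic_proj_in_flag[OF F' P' y(1) j'N] diff_hyperbolic_proj_orth[OF hyp, of y]
      vec.subspace_diff[OF sub] bform_hyperbolic_proj_orth[OF e(3)] by (auto simp: z_def)
  define f0 where "f0 = (1 / bform e z) *s z"
  have f0: "f0 \<in> F' ! ?j'" "f0 \<in> orth P" "bform e f0 = 1"
    using z vec.subspace_scale[OF sub] by (auto simp: f0_def orth_iff)
  \<comment> \<open>As \<open>bform e f0 = 1\<close> and e is isotropic, subtracting t times e
    lowers the norm of f0 by 2t.\<close>
  define f where "f = f0 - (bform f0 f0 / 2) *s e"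
  have ee: "bform e e = 0"
    using lev_add_ge[OF F, of e e] levF i by force
  have orth: "f \<in> orth P" using f0 e by (auto simp: f_def orth_iff)
  have ef: "bform e f = 1" using f0 ee by (simp add: f_def)
  have ff: "bform f f = 0"
    using f0(3) ee two bform_commute[of f0 e] by (simp add: f_def)
  \<comment> \<open>Up to j = n + 1 the correction by e stays inside \<open>F' ! ?j'\<close>. Beyond
    that \<open>?j' \<le> n\<close>, so f0 is already isotropic and the correction is zero.\<close>
  have "f \<in> F' ! ?j'"
  proof (cases "j \<le> n + 1")
    case True
    then have "j \<le> ?j'" by arith
    then have "e \<in> F' ! ?j'" using flag_mono[OF F' _ j'N] e by blast
    then show ?thesis
      unfolding f_def using f0(1) by (intro vec.subspace_diff[OF sub] vec.subspace_scale[OF sub])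
  next
    case False
    have "lev F' f0 \<le> ?j'" using f0(1) mem_flag_iff[OF F' j'N] by simp
    then have "bform f0 f0 = 0"
      using False lev_add_ge[OF F', of f0 f0] by force
    then show ?thesis using f0 by (simp add: f_def)
  qed
  then have "lev F' f \<le> ?j'" using mem_flag_iff[OF F' j'N] by simp
  then have L': "lev F' e + lev F' f = 2 * n + 2"
    using lev_add_ge[OF F', of e f] ef levF' j by simp
  \<comment> \<open>By minimality of i, the whole complement already lies in the member of F that
    should contain f.\<close>
  have "F ! (i - 1) \<inter> orth P \<subseteq> {0}" using Qmin[of "i - 1"] i0 by (fastforce simp: Q_def)
  then have "orth P \<subseteq> F ! (2 * n + 1 - (i - 1))"
    using i by (intro orth_subset_flag[OF F hyp P]) auto
  then have "f \<in> F ! (2 * n + 2 - i)" using orth i0 by auto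
  then have "lev F f \<le> 2 * n + 2 - i" using mem_flag_iff[OF F, of "2 * n + 2 - i" f] i0 by simp
  then have L: "lev F e + lev F f = 2 * n + 2"
    using lev_add_ge[OF F, of e f] ef levF i by simp
  show ?thesis using that[OF e(3) orth ee ff ef _ L L'] levF i by simp
qed

text \<open>One position out of each centrally symmetric pair, the centre (n + 1, n + 1) excluded.
  Vectors at these positions lie in F_n or in the intersection of F_(n+1) and F'_n.\<close>

definition positive_labels :: "nat \<Rightarrow> (nat \<times> nat) set" where
  "positive_labels n = {(i, j). i \<le> n \<or> i = n + 1 \<and> j \<le> n}"

text \<open>As long as F_n or F'_n meets the complement, \<open>hyperbolic_extension\<close>
  applies, with the flags exchanged in the second case. Each new pair makes the finite complement
  strictly smaller.\<close>

lemma hyperbolic_normal_form: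
  fixes F F' :: "('a::{field,finite} ^ 'r::finite bit0) set list"
  assumes F: "F \<in> isotropic_flags n" and F': "F' \<in> isotropic_flags n" and two: "(2::'a) \<noteq> 0"
  obtains P where "hyperbolic_system P" "compatible n F P" "compatible n F' P"
    "\<forall>p\<in>P. (lev F (fst p), lev F' (fst p)) \<in> positive_labels n"
    "F ! n \<inter> orth P \<subseteq> {0}" "F' ! n \<inter> orth P \<subseteq> {0}"
proof -
  define good where "good P \<longleftrightarrow> hyperbolic_system P \<and> compatible n F P \<and> compatible n F' P \<and>
    (\<forall>p\<in>P. (lev F (fst p), lev F' (fst p)) \<in> positive_labels n)" for P
  have "\<exists>Q. good Q \<and> F ! n \<inter> orth Q \<subseteq> {0} \<and> F' ! n \<inter> orth Q \<subseteq> {0}" if "good P" for P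
    using that
  proof (induction "card (orth P)" arbitrary: P rule: less_induct)
    case less
    then have hyp: "hyperbolic_system P" and P: "compatible n F P" and P': "compatible n F' P"
      by (auto simp: good_def)
    have step: ?case if *: "e \<in> orth P" "f \<in> orth P" "bform e e = 0" "bform f f = 0" "bform e f = 1"
      "lev F e + lev F f = 2 * n + 2" "lev F' e + lev F' f = 2 * n + 2"
      "(lev F e, lev F' e) \<in> positive_labels n" for e f
    proof (rule less.hyps)
      show "card (orth (insert (e, f) P)) < card (orth P)"
        using hyperbolic_system_insert(2)[OF hyp *(1-5)] by (intro psubset_card_mono) auto
      show "good (insert (e, f) P)"
        using less.prems * hyperbolic_system_insert(1)[OF hyp *(1-5)]
        by (auto simp: good_def compatible_def)
    qed
    consider "F ! n \<inter> orth P \<subseteq> {0}" "F' ! n \<inter> orth P \<subseteq> {0}" | "\<not> F ! n \<inter> orth P \<subseteq> {0}"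
      | "\<not> F' ! n \<inter> orth P \<subseteq> {0}" by blast
    then show ?case
    proof cases
      case 1
      then show ?thesis using less.prems by blast
    next
      case 2
      then obtain e f where *: "e \<in> orth P" "f \<in> orth P" "bform e e = 0" "bform f f = 0"
        "bform e f = 1" "lev F e \<le> n" "lev F e + lev F f = 2 * n + 2"
        "lev F' e + lev F' f = 2 * n + 2"
        by (rule hyperbolic_extension[OF F F' hyp P P' two])
      then show ?thesis by (intro step[of e f]) (auto simp: positive_labels_def)
    next
      case 3
      then obtain e f where *: "e \<in> orth P" "f \<in> orth P" "bform e e = 0" "bform f f = 0"
        "bform e f = 1" "lev F' e \<le> n" "lev F' e + lev F' f = 2 * n + 2"
        "lev F e + lev F f = 2 * n + 2"
        by (rule hyperbolic_extension[OF F' F hyp P' P two])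
      show ?thesis
      proof (cases "lev F e \<le> n + 1")
        case True
        then show ?thesis using * by (intro step[of e f]) (auto simp: positive_labels_def)
      next
        \<comment> \<open>Here the level of f in F is at most n, so the pair is entered in the
          opposite order.\<close>
        case False
        then show ?thesis using *
          by (intro step[of f e]) (auto simp: positive_labels_def bform_commute add.commute)
      qed
    qed
  qed
  moreover have "good {}" by (simp add: good_def hyperbolic_system_def compatible_def)
  ultimately obtain Q where "good Q" "F ! n \<inter> orth Q \<subseteq> {0}" "F' ! n \<inter> orth Q \<subseteq> {0}" by blast
  then show ?thesis by (intro that[of Q]) (auto simp: good_def)
qed

section \<open>Relative positions in an adapted basis\<close>

text \<open>Coordinates in B are unique, so a vector in both spans has none outside S and none
  outside T.\<close>

lemma span_Int_independent:
  fixes B :: "('a::field ^ 'n::finite) set"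
  assumes B: "vec.independent B" and S: "S \<subseteq> B" and T: "T \<subseteq> B"
  shows "vec.span S \<inter> vec.span T = vec.span (S \<inter> T)"
proof
  show "vec.span (S \<inter> T) \<subseteq> vec.span S \<inter> vec.span T"
    by (simp add: vec.span_mono)
  have fin: "finite B" "finite S" "finite T"
    using B S T by (auto intro: vec.finiteI_independent finite_subset)
  show "vec.span S \<inter> vec.span T \<subseteq> vec.span (S \<inter> T)"
  proof
    fix x assume "x \<in> vec.span S \<inter> vec.span T"
    then have "x \<in> range (\<lambda>u. \<Sum>v\<in>S. u v *s v)" "x \<in> range (\<lambda>u. \<Sum>v\<in>T. u v *s v)"
      using fin by (simp_all add: vec.span_finite)
    then obtain u w where u: "x = (\<Sum>v\<in>S. u v *s v)" and w: "x = (\<Sum>v\<in>T. w v *s v)"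
      by blast
    define u' where "u' v = (if v \<in> S then u v else 0)" for v
    define w' where "w' v = (if v \<in> T then w v else 0)" for v
    have u': "x = (\<Sum>v\<in>B. u' v *s v)"
      unfolding u u'_def using fin S by (intro sum.mono_neutral_cong_left) auto
    have w': "x = (\<Sum>v\<in>B. w' v *s v)"
      unfolding w w'_def using fin T by (intro sum.mono_neutral_cong_left) auto
    have "(\<Sum>v\<in>B. (u' v - w' v) *s v) = x - x"
      by (subst (2) w', subst u') (simp add: vec.scale_left_diff_distrib sum_subtractf)
    then have "u' v = w' v" if "v \<in> B" for v
      using vec.independentD[OF B fin(1) subset_refl, of "\<lambda>v. u' v - w' v" v] that by simp
    then have "u v = 0" if "v \<in> S - T" for v using that S by (force simp: u'_def w'_def)
    then have "x = (\<Sum>v\<in>S \<inter> T. u v *s v)"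
      unfolding u using fin by (intro sum.mono_neutral_right) auto
    also have "\<dots> \<in> vec.span (S \<inter> T)"
      by (intro vec.span_sum vec.span_scale vec.span_base)
    finally show "x \<in> vec.span (S \<inter> T)" .
  qed
qed

text \<open>Every member of both flags is spanned by a subset of B, so sums and intersections of
  members become unions and intersections of subsets, and dimensions become cardinalities.\<close>

lemma rel_pos_adapted_basis:
  assumes F: "F \<in> isotropic_flags n" and F': "F' \<in> isotropic_flags n"
    and B: "vec.independent B"
    and BF: "\<And>k. k \<le> 2 * n + 1 \<Longrightarrow> F ! k \<subseteq> vec.span (B \<inter> F ! k)"
    and BF': "\<And>k. k \<le> 2 * n + 1 \<Longrightarrow> F' ! k \<subseteq> vec.span (B \<inter> F' ! k)"
    and i: "i \<in> {1..2 * n + 1}" and j: "j \<in> {1..2 * n + 1}"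
  shows "rel_pos (2 * n + 1) F F' i j = card {b \<in> B. lev F b = i \<and> lev F' b = j}"
proof -
  have fin: "finite B" using B by (rule vec.finiteI_independent)
  have eq: "F ! k = vec.span {b \<in> B. lev F b \<le> k}" if k: "k \<le> 2 * n + 1" for k
  proof -
    have "vec.span (B \<inter> F ! k) = F ! k"
      using BF[OF k] flag_subspace[OF F k] by (intro antisym vec.span_minimal) auto
    moreover have "B \<inter> F ! k = {b \<in> B. lev F b \<le> k}" using mem_flag_iff[OF F k] by auto
    ultimately show ?thesis by simp
  qed
  have eq': "F' ! k = vec.span {b \<in> B. lev F' b \<le> k}" if k: "k \<le> 2 * n + 1" for k
  proof -
    have "vec.span (B \<inter> F' ! k) = F' ! k"
      using BF'[OF k] flag_subspace[OF F' k] by (intro antisym vec.span_minimal) auto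
    moreover have "B \<inter> F' ! k = {b \<in> B. lev F' b \<le> k}" using mem_flag_iff[OF F' k] by auto
    ultimately show ?thesis by simp
  qed
  define S where "S m = {b \<in> B. lev F b \<le> i - 1 \<or> lev F b \<le> i \<and> lev F' b \<le> m}" for m
  have dim: "vec.dim (flag_meet F F' i m) = card (S m)" if m: "m \<le> 2 * n + 1" for m
  proof -
    have "F ! i \<inter> F' ! m = vec.span ({b \<in> B. lev F b \<le> i} \<inter> {b \<in> B. lev F' b \<le> m})"
      unfolding eq'[OF m] using i by (subst eq) (auto intro!: span_Int_independent[OF B])
    moreover have "F ! (i - 1) = vec.span {b \<in> B. lev F b \<le> i - 1}" using i by (intro eq) auto
    ultimately have "flag_meet F F' i m
      = vec.span ({b \<in> B. lev F b \<le> i - 1} \<union> {b \<in> B. lev F b \<le> i} \<inter> {b \<in> B. lev F' b \<le> m})"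
      by (auto simp: flag_meet_def set_plus_def vec.span_Un)
    also have "{b \<in> B. lev F b \<le> i - 1} \<union> {b \<in> B. lev F b \<le> i} \<inter> {b \<in> B. lev F' b \<le> m} = S m"
      by (auto simp: S_def)
    finally show ?thesis
      using vec.independent_mono[OF B, of "S m"] vec.dim_span_eq_card_independent[of "S m"]
      by (auto simp: S_def)
  qed
  have "S (j - 1) \<subseteq> S j" by (auto simp: S_def)
  then have "card (S j) - card (S (j - 1)) = card (S j - S (j - 1))"
    using fin by (intro card_Diff_subset[symmetric]) (auto simp: S_def)
  also have "S j - S (j - 1) = {b \<in> B. lev F b = i \<and> lev F' b = j}"
    using i j by (auto simp: S_def)
  finally have "card (S j) - card (S (j - 1)) = card {b \<in> B. lev F b = i \<and> lev F' b = j}" .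
  moreover have "j - 1 \<le> 2 * n + 1" using j by auto
  ultimately show ?thesis using i j dim[of j] dim[of "j - 1"] by (simp add: rel_pos_def)
qed

text \<open>By \<open>orth_subset_flag\<close> with \<open>k = n\<close> the complement lies in
  F_(n+1), and it meets F_n only in 0.\<close>

lemma lev_orth:
  assumes F: "F \<in> isotropic_flags n" and "hyperbolic_system P" and "compatible n F P"
    and triv: "F ! n \<inter> orth P \<subseteq> {0}" and x: "x \<in> orth P" "x \<noteq> 0"
  shows "lev F x = n + 1"
proof -
  have "x \<in> F ! (2 * n + 1 - n)" using assms orth_subset_flag[of F n P n] by auto
  then have "lev F x \<le> n + 1" using mem_flag_iff[OF F, of "n + 1" x] by simp
  moreover have "\<not> lev F x \<le> n" using mem_flag_iff[OF F, of n x] triv x by auto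
  ultimately show ?thesis by simp
qed

text \<open>Split x into its projection and its component in \<open>orth P\<close>. The latter is 0
  for \<open>k \<le> n\<close>; for larger k all of C lies in \<open>F ! k\<close>.\<close>

lemma flag_subset_span:
  assumes F: "F \<in> isotropic_flags n" and hyp: "hyperbolic_system P" and P: "compatible n F P"
    and triv: "F ! n \<inter> orth P \<subseteq> {0}" and C: "C \<subseteq> orth P" "orth P \<subseteq> vec.span C"
    and k: "k \<le> 2 * n + 1"
  shows "F ! k \<subseteq> vec.span ((fst ` P \<union> snd ` P \<union> C) \<inter> F ! k)" (is "_ \<subseteq> vec.span ?B")
proof
  fix x assume x: "x \<in> F ! k"
  define y where "y = x - hyperbolic_proj P x"
  have "hyperbolic_proj P x \<in> vec.span ((fst ` P \<union> snd ` P) \<inter> F ! k)"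
    using hyperbolic_proj_in_span[OF F P _ k] x mem_flag_iff[OF F k] by simp
  then have 1: "hyperbolic_proj P x \<in> vec.span ?B"
    by (rule subsetD[OF vec.span_mono, rotated]) auto
  have y: "y \<in> F ! k" "y \<in> orth P"
    using x hyperbolic_proj_in_flag[OF F P x k] diff_hyperbolic_proj_orth[OF hyp, of x]
      vec.subspace_diff[OF flag_subspace[OF F k]] by (auto simp: y_def)
  have "y \<in> vec.span ?B"
  proof (cases "k \<le> n")
    case True
    then have "y = 0" using y triv flag_mono[OF F True] by auto
    then show ?thesis by (simp add: vec.span_zero)
  next
    case False
    then have "orth P \<subseteq> F ! k"
      using orth_subset_flag[OF F hyp P _ triv] flag_mono[OF F _ k, of "2 * n + 1 - n"] by auto
    then have "C \<subseteq> ?B" using C by auto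
    then show ?thesis using y C vec.span_mono by blast
  qed
  then show "x \<in> vec.span ?B" using vec.span_add[OF 1, of y] by (simp add: y_def)
qed

lemma hyperbolic_system_nz:
  assumes "hyperbolic_system P" "p \<in> P"
  shows "fst p \<noteq> 0" "snd p \<noteq> 0"
proof -
  have "bform (fst p) (snd p) = 1" using assms by (auto simp: hyperbolic_system_def)
  then show "fst p \<noteq> 0" "snd p \<noteq> 0" by auto
qed

text \<open>In a linear relation, the product with the partner of a pair vector isolates its
  coefficient. What remains is a relation within C.\<close>

lemma hyperbolic_system_independent:
  assumes P: "hyperbolic_system P" and C: "C \<subseteq> orth P" "vec.independent C"
  shows "vec.independent (fst ` P \<union> snd ` P \<union> C)" (is "vec.independent ?B")
proof -
  have fin: "finite P" "finite C"
    using P C(2) by (auto simp: hyperbolic_system_def vec.finiteI_independent)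
  have bf: "bform (fst p) (fst q) = 0" "bform (snd p) (snd q) = 0"
      "bform (fst p) (snd q) = (if p = q then 1 else 0)"
      "bform (snd p) (fst q) = (if p = q then 1 else 0)" if "p \<in> P" "q \<in> P" for p q
    using P that bform_commute[of "snd p" "fst q"] by (auto simp: hyperbolic_system_def)
  have Cz: "bform c (fst p) = 0" "bform c (snd p) = 0" if "c \<in> C" "p \<in> P" for c p
    using C that by (auto simp: orth_iff)
  have "u b = 0" if u: "(\<Sum>b\<in>?B. u b *s b) = 0" and b: "b \<in> ?B" for u b
  proof -
    have pair: "u b = 0" if "b \<in> ?B" "bform b y = 1" "\<And>c. c \<in> ?B \<Longrightarrow> c \<noteq> b \<Longrightarrow> bform c y = 0" for b y
    proof -
      have "0 = bform (\<Sum>b\<in>?B. u b *s b) y" by (simp add: u)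
      also have "\<dots> = (\<Sum>c\<in>?B. if c = b then u b else 0)"
        unfolding bform_sum_left using that by (intro sum.cong) auto
      finally show ?thesis using that(1) fin by simp
    qed
    have e: "u (fst p) = 0" if p: "p \<in> P" for p
      using p bf[OF _ p] Cz[OF _ p]
      by (intro pair[of "fst p" "snd p"]) (auto split: if_splits)
    have f: "u (snd p) = 0" if p: "p \<in> P" for p
      using p bf[OF _ p] Cz[OF _ p]
      by (intro pair[of "snd p" "fst p"]) (auto split: if_splits)
    have "(\<Sum>b\<in>?B. u b *s b) = (\<Sum>b\<in>C. u b *s b)"
      using fin e f by (intro sum.mono_neutral_right) auto
    then have "u c = 0" if "c \<in> C" for c
      using vec.independentD[OF C(2) fin(2) subset_refl _ that, of u] u by simp
    then show ?thesis using b e f by auto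
  qed
  then show ?thesis using fin by (intro vec.independent_if_scalars_zero) auto
qed

lemma positive_labels_reverse:
  assumes "(i, j) \<in> positive_labels n" "i + i' = 2 * n + 2" "j + j' = 2 * n + 2"
  shows "(i', j') \<notin> positive_labels n"
  using assms by (auto simp: positive_labels_def)

text \<open>The basis consists of the pairs and a basis C of the complement. First vectors have
  positive labels, second vectors the reversed ones, and C sits at the centre. So entries at
  positive labels count first vectors and the middle entry counts C.\<close>

lemma rel_pos_positive:
  assumes F: "F \<in> isotropic_flags n" and F': "F' \<in> isotropic_flags n"
    and hyp: "hyperbolic_system P" and P: "compatible n F P" and P': "compatible n F' P"
    and pos: "\<forall>p\<in>P. (lev F (fst p), lev F' (fst p)) \<in> positive_labels n"
    and triv: "F ! n \<inter> orth P \<subseteq> {0}" "F' ! n \<inter> orth P \<subseteq> {0}"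
    and ij: "i \<in> {1..2 * n + 1}" "j \<in> {1..2 * n + 1}"
  shows "(i, j) \<in> positive_labels n \<Longrightarrow>
      rel_pos (2 * n + 1) F F' i j = card {p \<in> P. (lev F (fst p), lev F' (fst p)) = (i, j)}"
    and "rel_pos (2 * n + 1) F F' (n + 1) (n + 1) = 0 \<longleftrightarrow> orth P = {0}"
proof -
  obtain C where C: "C \<subseteq> orth P" "vec.independent C" "orth P \<subseteq> vec.span C"
    by (rule vec.basis_exists[of "orth P"])
  let ?B = "fst ` P \<union> snd ` P \<union> C"
  have ind: "vec.independent ?B" using hyperbolic_system_independent[OF hyp C(1,2)] .
  have count: "rel_pos (2 * n + 1) F F' i j = card {b \<in> ?B. lev F b = i \<and> lev F' b = j}"
    if "i \<in> {1..2 * n + 1}" "j \<in> {1..2 * n + 1}" for i j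
    by (rule rel_pos_adapted_basis[OF F F' ind flag_subset_span[OF F hyp P triv(1) C(1,3)]
          flag_subset_span[OF F' hyp P' triv(2) C(1,3)] that])
  have levC: "lev F c = n + 1 \<and> lev F' c = n + 1" if "c \<in> C" for c
  proof -
    have "c \<noteq> 0" using C(2) that vec.dependent_zero by blast
    then show ?thesis
      using lev_orth[OF F hyp P triv(1)] lev_orth[OF F' hyp P' triv(2)] C(1) that by auto
  qed
  have lev_snd: "(lev F (snd p), lev F' (snd p)) \<notin> positive_labels n" if "p \<in> P" for p
    using positive_labels_reverse[OF bspec[OF pos that]] P P' that by (auto simp: compatible_def)
  have mid: "(n + 1, n + 1) \<notin> positive_labels n" by (simp add: positive_labels_def)
  {
    assume l: "(i, j) \<in> positive_labels n"
    have "{b \<in> ?B. lev F b = i \<and> lev F' b = j} = fst ` {p \<in> P. (lev F (fst p), lev F' (fst p)) = (i, j)}"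
      using l lev_snd levC mid by fastforce
    moreover have "inj_on fst P"
    proof (rule inj_onI)
      fix p q assume pq: "p \<in> P" "q \<in> P" "fst p = fst q"
      then have "bform (fst p) (snd q) = 1" using hyp by (simp add: hyperbolic_system_def)
      then show "p = q" using hyp pq(1,2) by (auto simp: hyperbolic_system_def split: if_splits)
    qed
    then have "inj_on fst {p \<in> P. (lev F (fst p), lev F' (fst p)) = (i, j)}"
      by (rule inj_on_subset) auto
    ultimately show "rel_pos (2 * n + 1) F F' i j
        = card {p \<in> P. (lev F (fst p), lev F' (fst p)) = (i, j)}"
      using count[OF ij] by (simp add: card_image)
  }
  have "{b \<in> ?B. lev F b = n + 1 \<and> lev F' b = n + 1} = C"
  proof -
    \<comment> \<open>If \<open>snd p\<close> sat at the centre, so would \<open>fst p\<close>, by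
      compatibility.\<close>
    have "(lev F b, lev F' b) \<noteq> (n + 1, n + 1)" if b: "b \<in> fst ` P \<union> snd ` P" for b
    proof -
      obtain p where p: "p \<in> P" "b = fst p \<or> b = snd p" using b by auto
      have "(lev F (fst p), lev F' (fst p)) \<noteq> (n + 1, n + 1)" using bspec[OF pos p(1)] mid by metis
      then show ?thesis using p P P' by (fastforce simp: compatible_def)
    qed
    then show ?thesis using levC by auto
  qed
  moreover have "finite C" using C(2) by (rule vec.finiteI_independent)
  ultimately have "rel_pos (2 * n + 1) F F' (n + 1) (n + 1) = 0 \<longleftrightarrow> C = {}"
    using count[of "n + 1" "n + 1"] by simp
  also have "\<dots> \<longleftrightarrow> orth P = {0}"
  proof
    assume "C = {}"
    then have "orth P \<subseteq> {0}" using C by simp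
    then show "orth P = {0}" by (auto simp: orth_iff)
  next
    assume "orth P = {0}"
    then have "C \<subseteq> {0}" using C by simp
    then show "C = {}" using C(2) vec.dependent_zero by blast
  qed
  finally show "rel_pos (2 * n + 1) F F' (n + 1) (n + 1) = 0 \<longleftrightarrow> orth P = {0}" .
qed

section \<open>Transitivity on pairs of flags in given relative position\<close>

lemma bij_betw_fibres:
  assumes fin: "finite P" "finite Q"
    and card: "\<And>l. card {p \<in> P. f p = l} = card {q \<in> Q. g q = l}"
  shows "\<exists>\<phi>. bij_betw \<phi> P Q \<and> (\<forall>p\<in>P. g (\<phi> p) = f p)"
proof -
  have "\<exists>h. bij_betw h {p \<in> P. f p = l} {q \<in> Q. g q = l}" for l
    using fin card by (intro finite_same_card_bij) auto
  then obtain h where h: "\<And>l. bij_betw (h l) {p \<in> P. f p = l} {q \<in> Q. g q = l}" by metis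
  define \<phi> where "\<phi> p = h (f p) p" for p
  have \<phi>: "\<phi> p \<in> Q" "g (\<phi> p) = f p" if "p \<in> P" for p
    using bij_betwE[OF h[of "f p"]] that by (auto simp: \<phi>_def)
  have "inj_on \<phi> P"
  proof (rule inj_onI)
    fix p q assume *: "p \<in> P" "q \<in> P" "\<phi> p = \<phi> q"
    then have "f p = f q" using \<phi> by metis
    then show "p = q" using * bij_betw_imp_inj_on[OF h[of "f p"]] by (auto simp: \<phi>_def inj_on_def)
  qed
  moreover have "Q \<subseteq> \<phi> ` P"
  proof
    fix q assume "q \<in> Q"
    then have "q \<in> h (g q) ` {p \<in> P. f p = g q}"
      using bij_betw_imp_surj_on[OF h[of "g q"]] by auto
    then obtain p where "p \<in> P" "f p = g q" "q = h (g q) p" by auto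
    then have "q = \<phi> p" by (simp add: \<phi>_def)
    then show "q \<in> \<phi> ` P" using \<open>p \<in> P\<close> by blast
  qed
  ultimately show ?thesis using \<phi> by (intro exI[of _ \<phi>]) (auto simp: bij_betw_def)
qed

section \<open>Isometries acting on flags\<close>

lemma orthogonal_image_perp:
  assumes g: "g \<in> orthogonal_group"
  shows "(*v) g ` perp X = perp ((*v) g ` X)"
proof
  show "(*v) g ` perp X \<subseteq> perp ((*v) g ` X)"
    using g by (auto simp: perp_def orthogonal_bform)
  show "perp ((*v) g ` X) \<subseteq> (*v) g ` perp X"
  proof
    fix y assume y: "y \<in> perp ((*v) g ` X)"
    have eq: "g *v (adj g *v y) = y" using orthogonal_adj[OF g] by (simp add: matrix_vector_mul_assoc)
    have "adj g *v y \<in> perp X"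
      using y orthogonal_bform[OF g, of "adj g *v y"] by (auto simp: perp_def eq)
    then show "y \<in> (*v) g ` perp X" using eq by (metis imageI)
  qed
qed

text \<open>The upper half of a flag consists of the complements of the lower half, and isometries
  commute with \<open>perp\<close>.\<close>

lemma act_flag_eqI:
  assumes F: "F \<in> isotropic_flags n" and G: "G \<in> isotropic_flags n" and g: "g \<in> orthogonal_group"
    and eq: "\<And>k. k \<le> n \<Longrightarrow> (*v) g ` (F ! k) = G ! k"
  shows "act_flag g F = G"
proof (rule nth_equalityI)
  show "length (act_flag g F) = length G"
    using flag_bounds(1)[OF F] flag_bounds(1)[OF G] by (simp add: act_flag_def)
  fix k assume "k < length (act_flag g F)"
  then have k: "k < length F" "k \<le> 2 * n + 1"
    using flag_bounds(1)[OF F] by (auto simp: act_flag_def)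
  have "(*v) g ` (F ! k) = G ! k"
  proof (cases "k \<le> n")
    case False
    then have "F ! k = perp (F ! (2 * n + 1 - k))" "G ! k = perp (G ! (2 * n + 1 - k))"
      using flag_perp[OF F, of "2 * n + 1 - k"] flag_perp[OF G, of "2 * n + 1 - k"] k by auto
    then show ?thesis using False eq[of "2 * n + 1 - k"] orthogonal_image_perp[OF g] by simp
  qed (rule eq)
  then show "act_flag g F ! k = G ! k" using k by (simp add: act_flag_def)
qed

lemma act_flag_mult: "act_flag (g ** h) F = act_flag g (act_flag h F)"
  by (simp add: act_flag_def image_image matrix_vector_mul_assoc)

lemma act_flag_one: "act_flag (mat 1) F = F"
  by (simp add: act_flag_def)

lemma act_flag_nth: "k < length F \<Longrightarrow> act_flag g F ! k = (*v) g ` (F ! k)"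
  by (simp add: act_flag_def)

lemma act_flag_isotropic:
  assumes F: "F \<in> isotropic_flags n" and g: "g \<in> orthogonal_group"
  shows "act_flag g F \<in> isotropic_flags n"
proof -
  have nth: "act_flag g F ! k = (*v) g ` (F ! k)" if "k \<le> 2 * n + 1" for k
    using that flag_bounds(1)[OF F] by (simp add: act_flag_nth)
  have inv: "invertible g" using g by (simp add: orthogonal_group_def)
  have "(*v) g ` UNIV = UNIV" using inv by (simp add: invertible_eq_bij bij_is_surj)
  moreover have "vec.subspace ((*v) g ` (F ! k))" if "k \<le> 2 * n + 1" for k
    using flag_subspace[OF F that] by (rule vec.subspace_image)
  moreover have "(*v) g ` (F ! i) \<subseteq> perp ((*v) g ` (F ! i))"
    "(*v) g ` (F ! (2 * n + 1 - i)) = perp ((*v) g ` (F ! i))" if "i \<le> n" for i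
  proof -
    have "F ! i \<subseteq> F ! (2 * n + 1 - i)" using that by (intro flag_mono[OF F]) auto
    moreover have "F ! (2 * n + 1 - i) = perp (F ! i)" using flag_perp[OF F, of i] that by simp
    ultimately show "(*v) g ` (F ! i) \<subseteq> perp ((*v) g ` (F ! i))"
      "(*v) g ` (F ! (2 * n + 1 - i)) = perp ((*v) g ` (F ! i))"
      by (auto simp flip: orthogonal_image_perp[OF g])
  qed
  moreover have "(*v) g ` (F ! i) \<subseteq> (*v) g ` (F ! (i + 1))" if "i < 2 * n + 1" for i
    using flag_mono[OF F, of i "i + 1"] that by (intro image_mono) auto
  moreover have "length (act_flag g F) = 2 * n + 2"
    using flag_bounds(1)[OF F] by (simp add: act_flag_def)
  ultimately show ?thesis
    unfolding isotropic_flags_def Let_def using flag_bounds(2,3)[OF F] by (auto simp: nth)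
qed

lemma rel_pos_act:
  assumes F: "F \<in> isotropic_flags n" and F': "F' \<in> isotropic_flags n" and g: "g \<in> orthogonal_group"
  shows "rel_pos (2 * n + 1) (act_flag g F) (act_flag g F') = rel_pos (2 * n + 1) F F'"
proof -
  have inj: "inj ((*v) g)" using g by (simp add: orthogonal_group_def invertible_eq_bij bij_is_inj)
  have "flag_meet (act_flag g F) (act_flag g F') i j = (*v) g ` flag_meet F F' i j"
    if "i \<le> 2 * n + 1" "j \<le> 2 * n + 1" for i j
  proof -
    have "(*v) g ` (X + Y) = (*v) g ` X + (*v) g ` Y" for X Y
      by (auto simp: set_plus_def matrix_vector_right_distrib image_iff)
        (metis matrix_vector_right_distrib)+
    then show ?thesis
      using that flag_bounds(1)[OF F] flag_bounds(1)[OF F']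
      by (simp add: flag_meet_def act_flag_nth image_Int[OF inj])
  qed
  moreover have "vec.dim ((*v) g ` X) = vec.dim X" for X
    using inj by (intro vec.dim_image_eq) (auto intro: inj_on_subset)
  ultimately show ?thesis by (auto simp: rel_pos_def fun_eq_iff)
qed

text \<open>For \<open>k \<le> n\<close> the member \<open>F ! k\<close> is spanned by the pair
  vectors it contains. The bijection keeps the levels of first vectors, hence by compatibility those
  of second vectors, so g maps one spanning set onto the other.\<close>

lemma hyperbolic_isometry_flag:
  assumes F: "F \<in> isotropic_flags n" and G: "G \<in> isotropic_flags n" and g: "g \<in> orthogonal_group"
    and P: "hyperbolic_system P" "compatible n F P" "F ! n \<inter> orth P \<subseteq> {0}"
    and Q: "hyperbolic_system Q" "compatible n G Q" "G ! n \<inter> orth Q \<subseteq> {0}"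
    and \<phi>: "bij_betw \<phi> P Q" "\<And>p. p \<in> P \<Longrightarrow> lev G (fst (\<phi> p)) = lev F (fst p)"
    and g\<phi>: "\<And>p. p \<in> P \<Longrightarrow> g *v fst p = fst (\<phi> p)" "\<And>p. p \<in> P \<Longrightarrow> g *v snd p = snd (\<phi> p)"
  shows "act_flag g F = G"
proof (rule act_flag_eqI[OF F G g])
  fix k assume k: "k \<le> n"
  have span: "H ! k = vec.span ((fst ` R \<union> snd ` R) \<inter> H ! k)"
    if H: "H \<in> isotropic_flags n" and R: "hyperbolic_system R" "compatible n H R"
      and triv: "H ! n \<inter> orth R \<subseteq> {0}" for H R
  proof
    show "vec.span ((fst ` R \<union> snd ` R) \<inter> H ! k) \<subseteq> H ! k"
      using flag_subspace[OF H] k by (intro vec.span_minimal) auto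
    show "H ! k \<subseteq> vec.span ((fst ` R \<union> snd ` R) \<inter> H ! k)"
    proof
      fix x assume x: "x \<in> H ! k"
      then have "x - hyperbolic_proj R x \<in> H ! k \<inter> orth R"
        using k hyperbolic_proj_in_flag[OF H R(2) x] diff_hyperbolic_proj_orth[OF R(1), of x]
          vec.subspace_diff[OF flag_subspace[OF H, of k]] by auto
      then have "x = hyperbolic_proj R x" using triv flag_mono[OF H k] by auto
      moreover have "hyperbolic_proj R x \<in> vec.span ((fst ` R \<union> snd ` R) \<inter> H ! k)"
        using x k mem_flag_iff[OF H, of k x] by (intro hyperbolic_proj_in_span[OF H R(2)]) auto
      ultimately show "x \<in> vec.span ((fst ` R \<union> snd ` R) \<inter> H ! k)" by simp
    qed
  qed
  have \<phi>Q: "\<phi> ` P = Q" using \<phi>(1) by (simp add: bij_betw_def)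
  have fst_iff: "fst (\<phi> p) \<in> G ! k \<longleftrightarrow> fst p \<in> F ! k" if "p \<in> P" for p
    using mem_flag_iff[OF F, of k] mem_flag_iff[OF G, of k] k \<phi>(2)[OF that] by simp
  have snd_iff: "snd (\<phi> p) \<in> G ! k \<longleftrightarrow> snd p \<in> F ! k" if "p \<in> P" for p
  proof -
    have "lev F (fst p) + lev F (snd p) = 2 * n + 2" "lev G (fst (\<phi> p)) + lev G (snd (\<phi> p)) = 2 * n + 2"
      using P(2) Q(2) \<phi>Q that by (auto simp: compatible_def)
    then have "lev G (snd (\<phi> p)) = lev F (snd p)" using \<phi>(2)[OF that] by simp
    then show ?thesis using mem_flag_iff[OF F, of k] mem_flag_iff[OF G, of k] k by simp
  qed
  have "(*v) g ` ((fst ` P \<union> snd ` P) \<inter> F ! k)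
      = (*v) g ` (fst ` {p \<in> P. fst p \<in> F ! k} \<union> snd ` {p \<in> P. snd p \<in> F ! k})"
    by (rule arg_cong[of _ _ "(`) ((*v) g)"]) auto
  also have "\<dots> = (\<lambda>p. fst (\<phi> p)) ` {p \<in> P. fst p \<in> F ! k} \<union> (\<lambda>p. snd (\<phi> p)) ` {p \<in> P. snd p \<in> F ! k}"
    unfolding image_Un image_image
    using g\<phi> by (intro arg_cong2[of _ _ _ _ "(\<union>)"] image_cong) auto
  also have "\<dots> = (fst ` Q \<union> snd ` Q) \<inter> G ! k"
    using fst_iff snd_iff by (auto simp flip: \<phi>Q)
  finally have "(*v) g ` vec.span ((fst ` P \<union> snd ` P) \<inter> F ! k) = vec.span ((fst ` Q \<union> snd ` Q) \<inter> G ! k)"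
    by (simp flip: vec.span_image)
  then show "(*v) g ` (F ! k) = G ! k" using span[OF F P] span[OF G Q] by simp
qed

lemma orthogonal_transitive_on_relative_position:
  fixes F F' G G' :: "('a::{field,finite} ^ 'r::finite bit0) set list"
  assumes F: "F \<in> isotropic_flags n" and F': "F' \<in> isotropic_flags n"
    and G: "G \<in> isotropic_flags n" and G': "G' \<in> isotropic_flags n"
    and eq: "rel_pos (2 * n + 1) F F' = rel_pos (2 * n + 1) G G'" and two: "(2::'a) \<noteq> 0"
  shows "\<exists>g\<in>orthogonal_group. act_flag g F = G \<and> act_flag g F' = G'"
proof -
  obtain P where P: "hyperbolic_system P" "compatible n F P" "compatible n F' P"
    "\<forall>p\<in>P. (lev F (fst p), lev F' (fst p)) \<in> positive_labels n"
    "F ! n \<inter> orth P \<subseteq> {0}" "F' ! n \<inter> orth P \<subseteq> {0}"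
    by (rule hyperbolic_normal_form[OF F F' two])
  obtain Q where Q: "hyperbolic_system Q" "compatible n G Q" "compatible n G' Q"
    "\<forall>p\<in>Q. (lev G (fst p), lev G' (fst p)) \<in> positive_labels n"
    "G ! n \<inter> orth Q \<subseteq> {0}" "G' ! n \<inter> orth Q \<subseteq> {0}"
    by (rule hyperbolic_normal_form[OF G G' two])
  have fin: "finite P" "finite Q" using P(1) Q(1) by (auto simp: hyperbolic_system_def)
  \<comment> \<open>On positive labels inside the matrix both sides equal the same entry; on all
    other labels both fibres are empty.\<close>
  have "card {p \<in> P. (lev F (fst p), lev F' (fst p)) = l}
      = card {q \<in> Q. (lev G (fst q), lev G' (fst q)) = l}" for l
  proof -
    obtain i j where l: "l = (i, j)" by fastforce
    show ?thesis
    proof (cases "l \<in> positive_labels n \<and> i \<in> {1..2 * n + 1} \<and> j \<in> {1..2 * n + 1}")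
      case True
      then show ?thesis
        using rel_pos_positive(1)[OF F F' P] rel_pos_positive(1)[OF G G' Q] eq l by simp
    next
      case False
      have "(lev F (fst p), lev F' (fst p)) \<noteq> l" if "p \<in> P" for p
        using False bspec[OF P(4) that] lev_pos[OF F, of "fst p"] lev_pos[OF F', of "fst p"]
          lev_le[OF F, of "fst p"] lev_le[OF F', of "fst p"] hyperbolic_system_nz[OF P(1) that] l
        by auto
      moreover have "(lev G (fst p), lev G' (fst p)) \<noteq> l" if "p \<in> Q" for p
        using False bspec[OF Q(4) that] lev_pos[OF G, of "fst p"] lev_pos[OF G', of "fst p"]
          lev_le[OF G, of "fst p"] lev_le[OF G', of "fst p"] hyperbolic_system_nz[OF Q(1) that] l
        by auto
      ultimately show ?thesis by (metis (mono_tags, lifting) empty_Collect_eq)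
    qed
  qed
  then obtain \<phi> where \<phi>: "bij_betw \<phi> P Q"
    "\<forall>p\<in>P. (lev G (fst (\<phi> p)), lev G' (fst (\<phi> p))) = (lev F (fst p), lev F' (fst p))"
    using bij_betw_fibres[OF fin, of "\<lambda>p. (lev F (fst p), lev F' (fst p))"
      "\<lambda>q. (lev G (fst q), lev G' (fst q))"] by auto
  \<comment> \<open>\<open>witt_extension\<close> asks for orthogonal anisotropic vectors; e + f and
    e - f are orthogonal with norms 2 and -2.\<close>
  define h where "h = (\<lambda>(p, b). if b then fst p + snd p else fst p - snd p :: 'a ^ 'r bit0)"
  have h: "bform (h (p, b)) (h (q, c)) = (if p = q \<and> b = c then if b then 2 else - 2 else 0)"
    if "hyperbolic_system R" "p \<in> R" "q \<in> R" for R p q b c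
    using that bform_commute[of "snd p" "fst q"] by (auto simp: h_def hyperbolic_system_def)
  have \<phi>Q: "\<phi> p \<in> Q" if "p \<in> P" for p using \<phi>(1) that by (auto simp: bij_betw_def)
  have \<phi>_inj: "\<phi> p = \<phi> q \<longleftrightarrow> p = q" if "p \<in> P" "q \<in> P" for p q
    using \<phi>(1) that by (auto simp: bij_betw_def inj_on_def)
  have "\<exists>g\<in>orthogonal_group. \<forall>k\<in>P \<times> UNIV. g *v h k = h (\<phi> (fst k), snd k)"
  proof (rule witt_extension)
    show "finite (P \<times> (UNIV :: bool set))" using fin by simp
    show "(2::'a) \<noteq> 0" by (rule two)
    fix k l assume "k \<in> P \<times> (UNIV :: bool set)" "l \<in> P \<times> (UNIV :: bool set)"
    then obtain p b q c where kl: "k = (p, b)" "l = (q, c)" and pq: "p \<in> P" "q \<in> P" by auto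
    show "bform (h k) (h l) = bform (h (\<phi> (fst k), snd k)) (h (\<phi> (fst l), snd l))"
      unfolding kl fst_conv snd_conv
      by (simp only: h[OF P(1) pq] h[OF Q(1) \<phi>Q[OF pq(1)] \<phi>Q[OF pq(2)]] \<phi>_inj[OF pq])
    show "bform (h k) (h l) = 0 \<longleftrightarrow> k \<noteq> l"
      unfolding kl h[OF P(1) pq] using two by auto
  qed
  then obtain g where g: "g \<in> orthogonal_group"
    "\<And>p b. p \<in> P \<Longrightarrow> g *v h (p, b) = h (\<phi> p, b)" by force
  have half: "(1 / 2) *s (x + x) = (x :: 'a ^ 'r bit0)" for x
    using two by (simp add: vec_eq_iff field_simps)
  have e: "fst p = (1 / 2) *s (h (p, True) + h (p, False))" for p
    using half[of "fst p"] by (simp add: h_def)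
  have f: "snd p = (1 / 2) *s (h (p, True) - h (p, False))" for p
    using half[of "snd p"] by (simp add: h_def)
  have gP: "g *v fst p = fst (\<phi> p)" "g *v snd p = snd (\<phi> p)" if "p \<in> P" for p
    by (simp_all only: e[of p] e[of "\<phi> p"] f[of p] f[of "\<phi> p"] vector_scalar_commute
        matrix_vector_right_distrib matrix_vector_mult_diff_distrib g(2)[OF that])
  have "act_flag g F = G"
    using \<phi> by (intro hyperbolic_isometry_flag[OF F G g(1) P(1,2,5) Q(1,2,5) _ _ gP]) auto
  moreover have "act_flag g F' = G'"
    using \<phi> by (intro hyperbolic_isometry_flag[OF F' G' g(1) P(1,3,6) Q(1,3,6) _ _ gP]) auto
  ultimately show ?thesis using g(1) by blast
qed

section \<open>Stabilizers\<close>

text \<open>The complement of the pairs is 0, so \<pi>, the projection onto the first vectors along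
  the second ones, has the isotropic image and kernel that \<open>det_stabilizer_lagrangian\<close>
  requires.\<close>

lemma stabilizer_det_1:
  fixes F F' :: "('a::{field,finite} ^ 'r::finite bit0) set list"
  assumes F: "F \<in> isotropic_flags n" and F': "F' \<in> isotropic_flags n" and two: "(2::'a) \<noteq> 0"
    and mid: "rel_pos (2 * n + 1) F F' (n + 1) (n + 1) = 0"
    and g: "g \<in> orthogonal_group" "act_flag g F = F" "act_flag g F' = F'"
  shows "det g = 1"
proof -
  obtain P where P: "hyperbolic_system P" "compatible n F P" "compatible n F' P"
    "\<forall>p\<in>P. (lev F (fst p), lev F' (fst p)) \<in> positive_labels n"
    "F ! n \<inter> orth P \<subseteq> {0}" "F' ! n \<inter> orth P \<subseteq> {0}"
    by (rule hyperbolic_normal_form[OF F F' two])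
  have "orth P = {0}"
    using rel_pos_positive(2)[OF F F' P, of 1 1] mid by simp
  then have decomp: "x = hyperbolic_proj P x" for x
    using diff_hyperbolic_proj_orth[OF P(1), of x] by auto
  define \<pi> where "\<pi> = matrix (\<lambda>x. \<Sum>p\<in>P. bform x (snd p) *s fst p)"
  have \<pi>: "\<pi> *v x = (\<Sum>p\<in>P. bform x (snd p) *s fst p)" for x
  proof -
    have "Vector_Spaces.linear (*s) (*s) (\<lambda>x. \<Sum>p\<in>P. bform x (snd p) *s fst p)"
      by unfold_locales
        (auto simp: vec.scale_left_distrib sum.distrib vec.scale_sum_right
          vec.scale_right_distrib algebra_simps)
    then show ?thesis by (simp add: \<pi>_def matrix_works)
  qed
  have compl: "x - \<pi> *v x = (\<Sum>p\<in>P. bform x (fst p) *s snd p)" for x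
    using decomp[of x] by (simp add: \<pi> hyperbolic_proj_def sum.distrib algebra_simps)
  have \<pi>_fix: "\<pi> *v x = x" if "\<And>p. p \<in> P \<Longrightarrow> bform x (fst p) = 0" for x
    using compl[of x] that by simp
  have fst_iso: "bform (fst p) (fst q) = 0" if "p \<in> P" "q \<in> P" for p q
    using P(1) that by (simp add: hyperbolic_system_def)
  \<comment> \<open>A union suffices in place of the sum: it spans the maximal isotropic subspace,
    contains all first vectors and is visibly preserved by g.\<close>
  define L where "L = F ! n \<union> F ! (n + 1) \<inter> F' ! n"
  have L_fix: "\<pi> *v x = x" if x: "x \<in> L" for x
  proof (rule \<pi>_fix, rule ccontr)
    fix p assume p: "p \<in> P" and ne: "bform x (fst p) \<noteq> 0"
    have "lev F x \<le> n \<or> lev F x \<le> n + 1 \<and> lev F' x \<le> n"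
      using x mem_flag_iff[OF F, of n x] mem_flag_iff[OF F, of "n + 1" x]
        mem_flag_iff[OF F', of n x] by (auto simp: L_def)
    moreover have "lev F (fst p) \<le> n \<or> lev F (fst p) = n + 1 \<and> lev F' (fst p) \<le> n"
      using P(4) p by (auto simp: positive_labels_def)
    ultimately show False
      using lev_add_ge[OF F ne] lev_add_ge[OF F' ne] by auto
  qed
  have gL: "g *v x \<in> L" if "x \<in> L" for x
  proof -
    have "act_flag g F ! k = (*v) g ` (F ! k)" "act_flag g F' ! k = (*v) g ` (F' ! k)"
      if "k \<le> n + 1" for k
      using that flag_bounds(1)[OF F] flag_bounds(1)[OF F'] by (simp_all add: act_flag_nth)
    then have "(*v) g ` (F ! n) = F ! n" "(*v) g ` (F ! (n + 1)) = F ! (n + 1)"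
      "(*v) g ` (F' ! n) = F' ! n"
      using g(2,3) by (metis le_add1, metis order_refl, metis le_add1)
    then show ?thesis using that unfolding L_def by blast
  qed
  have fst_L: "fst p \<in> L" if "p \<in> P" for p
    using P(4) that mem_flag_iff[OF F, of n "fst p"] mem_flag_iff[OF F, of "n + 1" "fst p"]
      mem_flag_iff[OF F', of n "fst p"] by (auto simp: L_def positive_labels_def)
  show ?thesis
  proof (rule det_stabilizer_lagrangian[OF g(1) two, where \<pi> = \<pi>])
    fix x y
    show "\<pi> *v (\<pi> *v x) = \<pi> *v x"
      by (rule \<pi>_fix) (auto simp: \<pi>[of x] bform_sum_left fst_iso)
    show "bform (\<pi> *v x) y = bform x (y - \<pi> *v y)"
    proof -
      have "bform (\<pi> *v x) y = (\<Sum>p\<in>P. bform x (snd p) * bform (fst p) y)"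
        by (simp only: \<pi> bform_sum_left bform_simps)
      also have "\<dots> = (\<Sum>p\<in>P. bform x (bform y (fst p) *s snd p))"
        by (intro sum.cong) (simp_all add: bform_commute[of y] mult.commute)
      finally show ?thesis by (simp only: compl bform_sum_right)
    qed
    show "\<pi> *v (g *v (\<pi> *v x)) = g *v (\<pi> *v x)"
      unfolding \<pi>[of x] using L_fix[OF gL[OF fst_L]]
      by (simp add: vec.sum vec.scale)
  qed
qed

text \<open>Vectors of level at most n are orthogonal to v by \<open>lev_add_ge\<close>, so the
  lower half of the flag is fixed pointwise.\<close>

lemma reflection_act_flag:
  assumes F: "F \<in> isotropic_flags n" and v: "lev F v = n + 1" "bform v v \<noteq> 0"
  shows "act_flag (reflection v) F = F"
proof (rule act_flag_eqI[OF F F reflection_orthogonal[OF v(2)]])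
  fix k assume k: "k \<le> n"
  have "reflection v *v x = x" if "x \<in> F ! k" for x
    using mem_flag_iff[OF F, of k x] k that lev_add_ge[OF F, of x v] v(1)
    by (intro reflection_fixes) force
  then show "(*v) (reflection v) ` (F ! k) = F ! k" by force
qed

text \<open>If all vectors of the complement were isotropic, polarization would make its vector w
  orthogonal to the complement and hence to the whole space, against nondegeneracy.\<close>

lemma stabilizer_reflection:
  fixes F F' :: "('a::{field,finite} ^ 'r::finite bit0) set list"
  assumes F: "F \<in> isotropic_flags n" and F': "F' \<in> isotropic_flags n" and two: "(2::'a) \<noteq> 0"
    and mid: "rel_pos (2 * n + 1) F F' (n + 1) (n + 1) \<noteq> 0"
  shows "\<exists>s\<in>orthogonal_group. det s = -1 \<and> act_flag s F = F \<and> act_flag s F' = F'"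
proof -
  obtain P where P: "hyperbolic_system P" "compatible n F P" "compatible n F' P"
    "\<forall>p\<in>P. (lev F (fst p), lev F' (fst p)) \<in> positive_labels n"
    "F ! n \<inter> orth P \<subseteq> {0}" "F' ! n \<inter> orth P \<subseteq> {0}"
    by (rule hyperbolic_normal_form[OF F F' two])
  have "0 \<in> orth P" by (simp add: orth_iff)
  moreover have "orth P \<noteq> {0}"
    using rel_pos_positive(2)[OF F F' P, of 1 1] mid by simp
  ultimately obtain w where w: "w \<in> orth P" "w \<noteq> 0" by blast
  have "\<exists>v\<in>orth P. bform v v \<noteq> 0"
  proof (rule ccontr)
    assume "\<not> ?thesis"
    then have iso: "bform v v = 0" if "v \<in> orth P" for v using that by blast
    have "bform w y = 0" for y
    proof -
      define z where "z = y - hyperbolic_proj P y"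
      have z: "z \<in> orth P" unfolding z_def by (rule diff_hyperbolic_proj_orth[OF P(1)])
      then have "w + z \<in> orth P" using w by (simp add: orth_iff)
      then have "bform (w + z) (w + z) = 0" by (rule iso)
      then have "2 * bform w z = 0" using iso[OF w(1)] iso[OF z] by (simp add: bform_commute[of z w])
      then have "bform w z = 0" using two by simp
      then show ?thesis using bform_hyperbolic_proj_orth[OF w(1), of y] by (simp add: z_def)
    qed
    then show False using w(2) bform_nondegenerate by blast
  qed
  then obtain v where v: "v \<in> orth P" "bform v v \<noteq> 0" by blast
  then have "v \<noteq> 0" by auto
  then have "lev F v = n + 1" "lev F' v = n + 1"
    using lev_orth[OF F P(1,2,5) v(1)] lev_orth[OF F' P(1,3,6) v(1)] by auto
  then show ?thesis
    using reflection_act_flag[OF F _ v(2)] reflection_act_flag[OF F' _ v(2)]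
      reflection_orthogonal[OF v(2)] det_reflection[OF v(2)] by blast
qed

lemma ex_orthogonal_det_minus_1:
  assumes "(2::'a::field) \<noteq> 0"
  shows "\<exists>s\<in>orthogonal_group. det (s :: 'a ^ 'r::finite bit0 ^ 'r bit0) = -1"
proof -
  \<comment> \<open>The indices 0 and 1, standing for the last and the first coordinate, are dual to
    each other, so v has norm 2.\<close>
  define v :: "'a ^ 'r bit0" where "v = axis 0 1 + axis 1 1"
  have "bform v v = v $ 1 + v $ 0" by (subst (2) v_def) (simp add: bform_axis)
  also have "\<dots> = 2" by (simp add: v_def axis_def)
  finally show ?thesis using assms reflection_orthogonal[of v] det_reflection[of v] by auto
qed

section \<open>Coordinate flags\<close>

text \<open>The number \<open>c k\<close> is the intended level of the k-th axis vector. Axis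
  vectors k and 1 - k have product 1, so their levels should add up to 2n + 2.\<close>

definition symmetric_label :: "nat \<Rightarrow> ('r::finite bit0 \<Rightarrow> nat) \<Rightarrow> bool" where
  "symmetric_label n c \<longleftrightarrow> (\<forall>k. 0 < c k \<and> c k + c (1 - k) = 2 * n + 2)"

lemma symmetric_labelD:
  assumes "symmetric_label n c"
  shows "0 < c k" "c k + c (1 - k) = 2 * n + 2" "c k \<le> 2 * n + 1"
proof -
  have *: "0 < c l" "c l + c (1 - l) = 2 * n + 2" for l
    using assms by (auto simp: symmetric_label_def)
  show "0 < c k" "c k + c (1 - k) = 2 * n + 2" by (rule *)+
  show "c k \<le> 2 * n + 1" using *(1)[of "1 - k"] *(2)[of k] by simp
qed

definition coord_flag :: "nat \<Rightarrow> ('r::finite bit0 \<Rightarrow> nat) \<Rightarrow> ('a::field ^ 'r bit0) set list" where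
  "coord_flag n c = map (\<lambda>i. {x. \<forall>k. x $ k \<noteq> 0 \<longrightarrow> c k \<le> i}) [0..<2 * n + 2]"

lemma coord_flag_nth:
  "i \<le> 2 * n + 1 \<Longrightarrow> coord_flag n c ! i = {x. \<forall>k. x $ k \<noteq> 0 \<longrightarrow> c k \<le> i}"
  by (simp add: coord_flag_def del: upt_Suc)

lemma coord_flag_isotropic:
  fixes c :: "'r::finite bit0 \<Rightarrow> nat"
  assumes label: "symmetric_label n c"
  shows "coord_flag n c \<in> (isotropic_flags n :: ('a::field ^ 'r bit0) set list set)"
proof -
  let ?F = "coord_flag n c :: ('a ^ 'r bit0) set list"
  note c = symmetric_labelD(1,2)[OF label] and c_le = symmetric_labelD(3)[OF label]
  have perp: "perp (?F ! i) = ?F ! (2 * n + 1 - i)" if i: "i \<le> 2 * n + 1" for i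
  proof
    show "perp (?F ! i) \<subseteq> ?F ! (2 * n + 1 - i)"
    proof
      fix x assume x: "x \<in> perp (?F ! i)"
      have "c k \<le> 2 * n + 1 - i" if "x $ k \<noteq> 0" for k
      proof (rule ccontr)
        assume "\<not> c k \<le> 2 * n + 1 - i"
        then have "c (1 - k) \<le> i" using c(2)[of k] by simp
        then have "axis (1 - k) 1 \<in> ?F ! i" using i by (simp add: coord_flag_nth axis_def)
        then have "bform x (axis (1 - k) 1) = 0" using x by (simp add: perp_def)
        then show False using that by (simp add: bform_axis)
      qed
      then show "x \<in> ?F ! (2 * n + 1 - i)" by (simp add: coord_flag_nth)
    qed
    show "?F ! (2 * n + 1 - i) \<subseteq> perp (?F ! i)"
    proof
      fix x assume x: "x \<in> ?F ! (2 * n + 1 - i)"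
      have "bform x y = 0" if y: "y \<in> ?F ! i" for y
      proof -
        have "x $ k * y $ (1 - k) = 0" for k
        proof (rule ccontr)
          assume "x $ k * y $ (1 - k) \<noteq> 0"
          then have "c k \<le> 2 * n + 1 - i" "c (1 - k) \<le> i"
            using x y i by (auto simp: coord_flag_nth)
          then show False using c(2)[of k] i by simp
        qed
        then show ?thesis unfolding bform_alt by (intro sum.neutral) blast
      qed
      then show "x \<in> perp (?F ! i)" by (simp add: perp_def)
    qed
  qed
  have nz: "c k \<noteq> 0" for k using c(1)[of k] by simp
  have "?F ! 0 = {0}" by (auto simp: nz coord_flag_nth vec_eq_iff)
  moreover have "?F ! (2 * n + 1) = UNIV" using c_le by (simp add: coord_flag_nth)
  moreover have mono: "?F ! i \<subseteq> ?F ! j" if "i \<le> j" "j \<le> 2 * n + 1" for i j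
    using that by (force simp: coord_flag_nth)
  moreover have "vec.subspace (?F ! i)" if "i \<le> 2 * n + 1" for i
    using that by (force simp: coord_flag_nth vec.subspace_def)
  moreover have "?F ! i \<subseteq> perp (?F ! i)" "?F ! (2 * n + 1 - i) = perp (?F ! i)" if "i \<le> n" for i
    using that perp[of i] mono[of i "2 * n + 1 - i"] by auto
  moreover have "length ?F = 2 * n + 2" by (simp add: coord_flag_def)
  ultimately show ?thesis unfolding isotropic_flags_def Let_def by auto
qed

text \<open>The standard basis is adapted to every coordinate flag, and axis vector k has level
  \<open>c k\<close>.\<close>

lemma rel_pos_coord_flag:
  fixes c c' :: "'r::finite bit0 \<Rightarrow> nat"
  assumes c: "symmetric_label n c" and c': "symmetric_label n c'"
    and ij: "i \<in> {1..2 * n + 1}" "j \<in> {1..2 * n + 1}"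
  shows "rel_pos (2 * n + 1) (coord_flag n c :: ('a::field ^ 'r bit0) set list) (coord_flag n c') i j
    = card {k. c k = i \<and> c' k = j}"
proof -
  let ?B = "cart_basis :: ('a ^ 'r bit0) set"
  have span: "coord_flag n d ! m \<subseteq> vec.span (?B \<inter> coord_flag n d ! m)" if m: "m \<le> 2 * n + 1" for m d
  proof
    fix x :: "'a ^ 'r bit0" assume x: "x \<in> coord_flag n d ! m"
    have "x $ k *s axis k 1 \<in> vec.span (?B \<inter> coord_flag n d ! m)" for k
    proof (cases "x $ k = 0")
      case False
      then have "axis k 1 \<in> ?B \<inter> coord_flag n d ! m"
        using x m by (auto simp: cart_basis_def coord_flag_nth axis_def)
      then show ?thesis by (intro vec.span_scale vec.span_base)
    qed (simp add: vec.span_zero)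
    then have "(\<Sum>k\<in>UNIV. x $ k *s axis k 1) \<in> vec.span (?B \<inter> coord_flag n d ! m)"
      by (intro vec.span_sum) auto
    then show "x \<in> vec.span (?B \<inter> coord_flag n d ! m)" by (simp add: basis_expansion)
  qed
  have lev: "lev (coord_flag n d) (axis k 1 :: 'a ^ 'r bit0) = d k"
    if d: "symmetric_label n d" for d k
  proof -
    have D: "coord_flag n d \<in> (isotropic_flags n :: ('a ^ 'r bit0) set list set)"
      using d by (rule coord_flag_isotropic)
    have "d k \<le> 2 * n + 1" using d by (rule symmetric_labelD)
    moreover have "(axis k 1 :: 'a ^ 'r bit0) \<in> coord_flag n d ! m \<longleftrightarrow> d k \<le> m" if "m \<le> 2 * n + 1" for m
      using that by (auto simp: coord_flag_nth axis_def)
    ultimately show ?thesis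
      using mem_flag_iff[OF D, of _ "axis k 1"] lev_le[OF D, of "axis k 1"] by (metis order_antisym order_refl)
  qed
  have "rel_pos (2 * n + 1) (coord_flag n c :: ('a ^ 'r bit0) set list) (coord_flag n c') i j
      = card {b \<in> ?B. lev (coord_flag n c) b = i \<and> lev (coord_flag n c') b = j}"
    by (rule rel_pos_adapted_basis[OF coord_flag_isotropic[OF c] coord_flag_isotropic[OF c']
          independent_cart_basis span span ij])
  also have "{b \<in> ?B. lev (coord_flag n c) b = i \<and> lev (coord_flag n c') b = j}
      = (\<lambda>k. axis k 1) ` {k. c k = i \<and> c' k = j}"
    using lev[OF c] lev[OF c'] by (auto simp: cart_basis_def)
  also have "card \<dots> = card {k. c k = i \<and> c' k = j}"
    by (intro card_image inj_onI) (auto simp: axis_eq_axis)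
  finally show ?thesis .
qed

text \<open>The first r coordinates contain one index from each dual pair k, 1 - k.\<close>

lemma ex_half_index_set:
  "\<exists>T :: 'r::finite bit0 set. card T = CARD('r) \<and> (\<forall>k. 1 - k \<in> T \<longleftrightarrow> k \<notin> T)"
proof -
  let ?T = "(of_nat :: nat \<Rightarrow> 'r bit0) ` {1..CARD('r)}"
  have inj: "inj_on (of_nat :: nat \<Rightarrow> 'r bit0) {1..2 * CARD('r)}"
    and surj: "of_nat ` {1..2 * CARD('r)} = (UNIV :: 'r bit0 set)"
    using bij_betw_of_nat_bit0 by (auto simp: bij_betw_def)
  have mem: "of_nat i \<in> ?T \<longleftrightarrow> i \<le> CARD('r)" if "i \<in> {1..2 * CARD('r)}" for i
    using that by (auto simp: inj_on_image_mem_iff[OF inj])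
  have "1 - k \<in> ?T \<longleftrightarrow> k \<notin> ?T" for k
  proof -
    have "k \<in> of_nat ` {1..2 * CARD('r)}" using surj by simp
    then obtain i where i: "i \<in> {1..2 * CARD('r)}" "k = of_nat i" by blast
    then have "2 * CARD('r) + 1 - i \<in> {1..2 * CARD('r)}" by auto
    then have "of_nat (2 * CARD('r) + 1 - i) \<in> ?T \<longleftrightarrow> of_nat i \<notin> ?T"
      using i by (simp only: mem) auto
    then show ?thesis using i by (simp only: of_nat_reverse_bit0)
  qed
  moreover have "card ?T = CARD('r)"
    by (subst card_image) (auto intro: inj_on_subset[OF inj])
  ultimately show ?thesis by blast
qed

text \<open>Apart from the centre, whose entry is 0, the positions split into positive labels and
  their reversals, and these have equal entries.\<close>

lemma sum_positive_labels:
  assumes A: "A \<in> Xi (2 * n + 1) (2 * r)" and mid: "A (n + 1) (n + 1) = 0"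
  shows "(\<Sum>(i, j)\<in>positive_labels n \<inter> {1..2 * n + 1} \<times> {1..2 * n + 1}. A i j) = r"
proof -
  let ?I = "{1..2 * n + 1} \<times> {1..2 * n + 1}"
  let ?H = "positive_labels n \<inter> ?I"
  let ?rev = "\<lambda>(i, j). (2 * n + 2 - i, 2 * n + 2 - j)"
  let ?f = "\<lambda>(i, j). A i j"
  have I: "?I = ?H \<union> (?rev ` ?H \<union> {(n + 1, n + 1)})"
  proof
    show "?I \<subseteq> ?H \<union> (?rev ` ?H \<union> {(n + 1, n + 1)})"
    proof
      fix l assume l: "l \<in> ?I"
      then obtain i j where ij: "l = (i, j)" "i \<in> {1..2 * n + 1}" "j \<in> {1..2 * n + 1}" by auto
      show "l \<in> ?H \<union> (?rev ` ?H \<union> {(n + 1, n + 1)})"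
      proof (cases "l \<in> ?H \<or> l = (n + 1, n + 1)")
        case False
        then have "?rev l \<in> ?H" "?rev (?rev l) = l" using ij by (auto simp: positive_labels_def)
        then have "l \<in> ?rev ` ?H" by (intro image_eqI[of l ?rev "?rev l"]) auto
        then show ?thesis by simp
      qed auto
    qed
  qed auto
  have "(\<Sum>i = 1..2 * n + 1. \<Sum>j = 1..2 * n + 1. A i j) = 2 * r"
    using A unfolding Xi_def by blast
  then have "2 * r = (\<Sum>l\<in>?I. ?f l)"
    unfolding sum.cartesian_product by simp
  also have "\<dots> = (\<Sum>l\<in>?H. ?f l) + (\<Sum>l\<in>?rev ` ?H \<union> {(n + 1, n + 1)}. ?f l)"
    by (subst I, rule sum.union_disjoint) (auto simp: positive_labels_def)
  also have "(\<Sum>l\<in>?rev ` ?H \<union> {(n + 1, n + 1)}. ?f l) = (\<Sum>l\<in>?rev ` ?H. ?f l)"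
    using mid by (intro sum.mono_neutral_right) auto
  also have "\<dots> = (\<Sum>l\<in>?H. ?f (?rev l))"
    by (rule sum.reindex_cong[of ?rev]) (auto simp: inj_on_def)
  also have "\<dots> = (\<Sum>l\<in>?H. ?f l)"
    using A by (intro sum.cong) (auto simp: Xi_def)
  finally show ?thesis by simp
qed

text \<open>Half of the indices receive positive labels with the multiplicities prescribed by A;
  \<open>sum_positive_labels\<close> says that there are exactly enough. Duality forces the labels
  of the other half.\<close>

lemma ex_symmetric_labels:
  assumes A: "A \<in> Xi (2 * n + 1) (2 * CARD('r::finite))" and mid: "A (n + 1) (n + 1) = 0"
  shows "\<exists>c c' :: 'r bit0 \<Rightarrow> nat. symmetric_label n c \<and> symmetric_label n c' \<and>
    (\<forall>i\<in>{1..2 * n + 1}. \<forall>j\<in>{1..2 * n + 1}. card {k. c k = i \<and> c' k = j} = A i j)"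
proof -
  define H where "H = positive_labels n \<inter> {1..2 * n + 1} \<times> {1..2 * n + 1}"
  have finH: "finite H" by (simp add: H_def)
  obtain T :: "'r bit0 set" where T: "card T = CARD('r)" "\<And>k. 1 - k \<in> T \<longleftrightarrow> k \<notin> T"
    using ex_half_index_set by blast
  have "card (SIGMA l:H. {..<A (fst l) (snd l)}) = CARD('r)"
    using sum_positive_labels[OF A mid] finH by (simp add: H_def case_prod_unfold)
  then obtain b where b: "bij_betw b T (SIGMA l:H. {..<A (fst l) (snd l)})"
    using finite_same_card_bij[of T "SIGMA l:H. {..<A (fst l) (snd l)}"] T(1) finH by auto
  define d where "d k = fst (b k)" for k
  have dH: "d k \<in> H" if "k \<in> T" for k
    using bij_betwE[OF b] that by (force simp: d_def)
  have card_d: "card {k \<in> T. d k = l} = A (fst l) (snd l)" if "l \<in> H" for l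
  proof -
    have "b ` {k \<in> T. d k = l} = {l} \<times> {..<A (fst l) (snd l)}"
    proof
      show "b ` {k \<in> T. d k = l} \<subseteq> {l} \<times> {..<A (fst l) (snd l)}"
        using bij_betwE[OF b] by (force simp: d_def)
      show "{l} \<times> {..<A (fst l) (snd l)} \<subseteq> b ` {k \<in> T. d k = l}"
      proof
        fix y assume y: "y \<in> {l} \<times> {..<A (fst l) (snd l)}"
        then have "y \<in> b ` T" using that bij_betw_imp_surj_on[OF b] by auto
        then obtain k where k: "k \<in> T" "y = b k" by auto
        then have "d k = l" using y by (auto simp: d_def)
        then show "y \<in> b ` {k \<in> T. d k = l}" using k by simp
      qed
    qed
    moreover have "inj_on b {k \<in> T. d k = l}"
      using bij_betw_imp_inj_on[OF b] by (rule inj_on_subset) auto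
    ultimately have "card {k \<in> T. d k = l} = card ({l} \<times> {..<A (fst l) (snd l)})"
      using card_image[of b "{k \<in> T. d k = l}"] by simp
    then show ?thesis by simp
  qed
  define c where "c k = (if k \<in> T then fst (d k) else 2 * n + 2 - fst (d (1 - k)))" for k
  define c' where "c' k = (if k \<in> T then snd (d k) else 2 * n + 2 - snd (d (1 - k)))" for k
  have lab: "symmetric_label n c" "symmetric_label n c'"
  proof -
    have "fst (d k) \<in> {1..2 * n + 1}" "snd (d k) \<in> {1..2 * n + 1}" if "k \<in> T" for k
      using dH[OF that] by (auto simp: H_def)
    then have *: "0 < fst (d k)" "fst (d k) < 2 * n + 2" "0 < snd (d k)" "snd (d k) < 2 * n + 2"
      if "k \<in> T" for k using that by force+
    show "symmetric_label n c"
      unfolding symmetric_label_def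
    proof
      fix k show "0 < c k \<and> c k + c (1 - k) = 2 * n + 2"
        using *(1,2)[of k] *(1,2)[of "1 - k"] T(2)[of k] by (auto simp: c_def)
    qed
    show "symmetric_label n c'"
      unfolding symmetric_label_def
    proof
      fix k show "0 < c' k \<and> c' k + c' (1 - k) = 2 * n + 2"
        using *(3,4)[of k] *(3,4)[of "1 - k"] T(2)[of k] by (auto simp: c'_def)
    qed
  qed
  note sym = symmetric_labelD[OF lab(1)] symmetric_labelD[OF lab(2)]
  \<comment> \<open>Thus fibres over positive labels can be counted inside T, reversed labels reduce
    to them by exchanging k and 1 - k, and the centre is never hit.\<close>
  have T_iff: "(c k, c' k) \<in> positive_labels n \<longleftrightarrow> k \<in> T" for k
  proof
    assume pos: "(c k, c' k) \<in> positive_labels n"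
    show "k \<in> T"
    proof (rule ccontr)
      assume "k \<notin> T"
      then have "1 - k \<in> T" using T(2) by simp
      then have "(c (1 - k), c' (1 - k)) \<in> positive_labels n"
        using dH[of "1 - k"] by (simp add: c_def c'_def H_def)
      then show False using positive_labels_reverse[OF pos sym(2)[of k] sym(5)[of k]] by simp
    qed
  next
    assume "k \<in> T"
    then show "(c k, c' k) \<in> positive_labels n" using dH[of k] by (simp add: c_def c'_def H_def)
  qed
  have pos: "card {k. c k = i \<and> c' k = j} = A i j" if "(i, j) \<in> H" for i j
  proof -
    have "{k. c k = i \<and> c' k = j} = {k \<in> T. d k = (i, j)}"
    proof (rule Collect_cong)
      fix k
      have "k \<in> T" if "c k = i" "c' k = j"
        using T_iff[of k] \<open>(i, j) \<in> H\<close> that by (simp add: H_def)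
      then show "(c k = i \<and> c' k = j) = (k \<in> T \<and> d k = (i, j))"
        by (cases "d k") (auto simp: c_def c'_def)
    qed
    then show ?thesis using card_d[OF that] by simp
  qed
  have "card {k. c k = i \<and> c' k = j} = A i j" if ij: "i \<in> {1..2 * n + 1}" "j \<in> {1..2 * n + 1}" for i j
  proof -
    let ?i = "2 * n + 2 - i" and ?j = "2 * n + 2 - j"
    consider "(i, j) \<in> H" | "(?i, ?j) \<in> H" | "i = n + 1" "j = n + 1"
      using ij by (force simp: H_def positive_labels_def)
    then show ?thesis
    proof cases
      case 1
      then show ?thesis by (rule pos)
    next
      case 2
      have rev: "c (1 - k) = ?i \<and> c' (1 - k) = ?j \<longleftrightarrow> c k = i \<and> c' k = j" for k
        using sym(2)[of k] sym(5)[of k] ij by auto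
      have "bij_betw (\<lambda>k. 1 - k) {k. c k = i \<and> c' k = j} {k. c k = ?i \<and> c' k = ?j}"
      proof (rule bij_betw_byWitness[where f' = "\<lambda>k. 1 - k"])
        show "(\<lambda>k. 1 - k) ` {k. c k = ?i \<and> c' k = ?j} \<subseteq> {k. c k = i \<and> c' k = j}"
        proof clarify
          fix k assume "c k = ?i" "c' k = ?j"
          then show "c (1 - k) = i \<and> c' (1 - k) = j" using rev[of "1 - k"] by simp
        qed
      qed (use rev in auto)
      then have "card {k. c k = i \<and> c' k = j} = card {k. c k = ?i \<and> c' k = ?j}"
        by (rule bij_betw_same_card)
      also have "\<dots> = A ?i ?j" using 2 by (rule pos)
      also have "\<dots> = A i j" using A ij by (auto simp: Xi_def)
      finally show ?thesis .
    next
      case 3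
      have "\<not> (c k = n + 1 \<and> c' k = n + 1)" for k
        using T_iff[of k] T_iff[of "1 - k"] T(2)[of k] sym(2)[of k] sym(5)[of k]
        by (auto simp: positive_labels_def)
      then show ?thesis using 3 mid by simp
    qed
  qed
  then show ?thesis using lab by blast
qed

lemma ex_flags_rel_pos:
  assumes A: "A \<in> Xi (2 * n + 1) (2 * CARD('r::finite))" and mid: "A (n + 1) (n + 1) = 0"
  shows "\<exists>F F' :: ('a::field ^ 'r bit0) set list.
    F \<in> isotropic_flags n \<and> F' \<in> isotropic_flags n \<and> rel_pos (2 * n + 1) F F' = A"
proof -
  obtain c c' :: "'r bit0 \<Rightarrow> nat" where c: "symmetric_label n c" "symmetric_label n c'"
    and card: "\<And>i j. i \<in> {1..2 * n + 1} \<Longrightarrow> j \<in> {1..2 * n + 1} \<Longrightarrow> card {k. c k = i \<and> c' k = j} = A i j"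
    using ex_symmetric_labels[OF A mid] by blast
  have "rel_pos (2 * n + 1) (coord_flag n c :: ('a ^ 'r bit0) set list) (coord_flag n c') i j = A i j"
    for i j
  proof (cases "i \<in> {1..2 * n + 1} \<and> j \<in> {1..2 * n + 1}")
    case True
    then show ?thesis using card by (subst rel_pos_coord_flag[OF c]) auto
  next
    case False
    then have "A i j = 0" using A unfolding Xi_def by blast
    then show ?thesis using False by (auto simp: rel_pos_def)
  qed
  then show ?thesis using coord_flag_isotropic[OF c(1)] coord_flag_isotropic[OF c(2)] by blast
qed

text \<open>Adding 1 permutes the field, so comparing sums over all elements shows that its
  cardinality is 0 in it. If 2 = 0, an odd cardinality would be 1.\<close>

lemma two_neq_zero_if_odd_card:
  assumes "odd CARD('a::{field,finite})"
  shows "(2::'a) \<noteq> 0"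
proof
  assume two: "(2::'a) = 0"
  have "(\<Sum>x\<in>UNIV. x + 1) = (\<Sum>x\<in>(UNIV :: 'a set). x)"
    by (rule sum.reindex_bij_betw[where h = "\<lambda>x. x + 1"])
      (rule bij_betw_byWitness[where f' = "\<lambda>x. x - 1"], auto)
  then have "(of_nat CARD('a) :: 'a) = 0" by (simp add: sum.distrib)
  moreover have "(of_nat CARD('a) :: 'a) = 1" using assms two by (auto elim!: oddE)
  ultimately show False by simp
qed

section \<open>Splitting of orbits\<close>

lemma pair_orbit_subset_orbit_of_matrix:
  assumes "(F, F') \<in> orbit_of_matrix n A" "G \<subseteq> orthogonal_group"
  shows "pair_orbit G (F, F') \<subseteq> orbit_of_matrix n A"
proof -
  have F: "F \<in> isotropic_flags n" "F' \<in> isotropic_flags n" "rel_pos (2 * n + 1) F F' = A"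
    using assms(1) by (auto simp: orbit_of_matrix_def)
  have "(act_flag g F, act_flag g F') \<in> orbit_of_matrix n A" if "g \<in> orthogonal_group" for g
    using F act_flag_isotropic[OF _ that] rel_pos_act[OF F(1,2) that] by (simp add: orbit_of_matrix_def)
  then show ?thesis using assms(2) by (auto simp: pair_orbit_def)
qed

text \<open>A stabilizing s of determinant -1 corrects the determinant of any g joining two points,
  so there cannot be two orbits. If the stabilizer lies in the special orthogonal group, any
  isometry of determinant -1 carries (F, F') into the second orbit.\<close>

theorem proposition4p5:
  fixes n p k :: nat
    and A :: "nat \<Rightarrow> nat \<Rightarrow> nat"
    and OA :: "(('a::{field,finite} ^ 'r::finite bit0) set list \<times> ('a ^ 'r bit0) set list) set"
  assumes "n \<ge> 1"
    and "CARD('r) \<ge> 2"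
    and "prime p" and "odd p" and "CARD('a) = p ^ k"
    and "A \<in> Xi (2 * n + 1) (2 * CARD('r))"
    and "OA = orbit_of_matrix n A"
  shows "(\<exists>P\<in>pair_orbits special_orthogonal_group n. \<exists>Q\<in>pair_orbits special_orthogonal_group n.
            P \<inter> Q = {} \<and> OA = P \<union> Q)
         \<longleftrightarrow> A (n + 1) (n + 1) = 0"
proof -
  have two: "(2::'a) \<noteq> 0" using assms by (intro two_neq_zero_if_odd_card) simp
  have transitive: "\<exists>g\<in>orthogonal_group. act_flag g F = G \<and> act_flag g F' = G'"
    if "(F, F') \<in> OA" "(G, G') \<in> OA" for F F' G G'
    using that assms(7) two
    by (intro orthogonal_transitive_on_relative_position) (auto simp: orbit_of_matrix_def)
  have SO_sub: "special_orthogonal_group \<subseteq> (orthogonal_group :: ('a ^ 'r bit0 ^ 'r bit0) set)"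
    by (auto simp: special_orthogonal_group_def)
  show ?thesis
  proof
    assume "\<exists>P\<in>pair_orbits special_orthogonal_group n. \<exists>Q\<in>pair_orbits special_orthogonal_group n.
      P \<inter> Q = {} \<and> OA = P \<union> Q"
    then obtain F F' G G'
      where disj: "pair_orbit special_orthogonal_group (F, F') \<inter> pair_orbit special_orthogonal_group (G, G') = {}"
      and OA: "OA = pair_orbit special_orthogonal_group (F, F') \<union> pair_orbit special_orthogonal_group (G, G')"
      unfolding pair_orbits_def by auto
    have self: "(H, H') \<in> pair_orbit special_orthogonal_group (H, H')"
      for H H' :: "('a ^ 'r bit0) set list"
      unfolding pair_orbit_def special_orthogonal_group_def
      by (auto intro!: exI[of _ "mat 1"] simp: act_flag_one orthogonal_one)
    then have mem: "(F, F') \<in> OA" "(G, G') \<in> OA" using OA by auto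
    show "A (n + 1) (n + 1) = 0"
    proof (rule ccontr)
      assume nz: "A (n + 1) (n + 1) \<noteq> 0"
      obtain g where g: "g \<in> orthogonal_group" "act_flag g F = G" "act_flag g F' = G'"
        using transitive[OF mem] by blast
      obtain s where s: "s \<in> orthogonal_group" "det s = -1" "act_flag s F = F" "act_flag s F' = F'"
        using stabilizer_reflection[of F n F'] mem(1) nz assms(7) two
        by (auto simp: orbit_of_matrix_def)
      have "\<exists>h\<in>special_orthogonal_group. act_flag h F = G \<and> act_flag h F' = G'"
      proof (cases "det g = 1")
        case True
        then show ?thesis using g by (auto simp: special_orthogonal_group_def)
      next
        case False
        then have "det (g ** s) = 1" using orthogonal_det[OF g(1)] s(2) by (simp add: det_mul)
        then show ?thesis using g s
          by (intro bexI[of _ "g ** s"])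
            (auto simp: special_orthogonal_group_def act_flag_mult orthogonal_mult)
      qed
      then have "(G, G') \<in> pair_orbit special_orthogonal_group (F, F')"
        by (auto simp: pair_orbit_def)
      then show False using self disj by blast
    qed
  next
    assume mid: "A (n + 1) (n + 1) = 0"
    obtain F F' :: "('a ^ 'r bit0) set list"
      where F: "F \<in> isotropic_flags n" "F' \<in> isotropic_flags n" "rel_pos (2 * n + 1) F F' = A"
      using ex_flags_rel_pos[OF assms(6) mid] by blast
    then have mem: "(F, F') \<in> OA" using assms(7) by (simp add: orbit_of_matrix_def)
    obtain s :: "'a ^ 'r bit0 ^ 'r bit0" where s: "s \<in> orthogonal_group" "det s = -1"
      using ex_orthogonal_det_minus_1[OF two] by blast
    let ?P = "pair_orbit special_orthogonal_group (F, F')"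
    let ?Q = "pair_orbit special_orthogonal_group (act_flag s F, act_flag s F')"
    have sF: "act_flag s F \<in> isotropic_flags n" "act_flag s F' \<in> isotropic_flags n"
      using F(1,2) s(1) by (auto intro: act_flag_isotropic)
    then have s_mem: "(act_flag s F, act_flag s F') \<in> OA"
      using F assms(7) rel_pos_act[OF F(1,2) s(1)] by (simp add: orbit_of_matrix_def)
    have adj_s: "adj s \<in> orthogonal_group" "adj s ** s = mat 1" "det (adj s) = -1"
      using orthogonal_adj[OF s(1)] s(2) by (auto simp: det_adj)
    have "?P \<inter> ?Q = {}"
    proof (rule ccontr)
      assume "?P \<inter> ?Q \<noteq> {}"
      then obtain g h where g: "g \<in> orthogonal_group" "det g = 1" and h: "h \<in> orthogonal_group" "det h = 1"
        and eq: "act_flag g F = act_flag h (act_flag s F)" "act_flag g F' = act_flag h (act_flag s F')"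
        by (auto simp: pair_orbit_def special_orthogonal_group_def)
      \<comment> \<open>A common point of the two orbits would give an element of the stabilizer
        with determinant -1.\<close>
      have "act_flag (adj g ** (h ** s)) H = act_flag (adj g ** g) H"
        if "act_flag g H = act_flag h (act_flag s H)" for H
        using that by (simp add: act_flag_mult)
      then have "act_flag (adj g ** (h ** s)) F = F" "act_flag (adj g ** (h ** s)) F' = F'"
        using eq orthogonal_adj(1)[OF g(1)] by (auto simp: act_flag_one)
      moreover have "adj g ** (h ** s) \<in> orthogonal_group"
        using g h s orthogonal_adj(3) by (intro orthogonal_mult) auto
      ultimately have "det (adj g ** (h ** s)) = 1"
        using F mid by (intro stabilizer_det_1[OF F(1,2) two]) auto
      then have "(-1 :: 'a) = 1" using g h s by (simp add: det_mul det_adj)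
      then show False using two by (metis add.inverse_inverse add_eq_0_iff one_add_one)
    qed
    moreover have "OA \<subseteq> ?P \<union> ?Q"
    proof clarify
      fix G G' assume G: "(G, G') \<in> OA" "(G, G') \<notin> ?Q"
      obtain g where g: "g \<in> orthogonal_group" "act_flag g F = G" "act_flag g F' = G'"
        using transitive[OF mem G(1)] by blast
      have "det g = 1"
      proof (rule ccontr)
        assume "det g \<noteq> 1"
        \<comment> \<open>Here \<open>adj s\<close> is the inverse of s, so g is s followed by an
          element of determinant 1.\<close>
        then have "det (g ** adj s) = 1" using orthogonal_det[OF g(1)] adj_s by (simp add: det_mul)
        then have "g ** adj s \<in> special_orthogonal_group"
          using g(1) adj_s(1) by (simp add: special_orthogonal_group_def orthogonal_mult)
        moreover have "act_flag (g ** adj s) (act_flag s H) = act_flag g H" for H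
          using adj_s(2) by (simp add: act_flag_one matrix_mul_assoc[symmetric] flip: act_flag_mult)
        ultimately have "(G, G') \<in> ?Q"
          unfolding pair_orbit_def mem_Collect_eq
          using g(2,3) by (intro exI[of _ "g ** adj s"]) simp
        then show False using G(2) by simp
      qed
      then show "(G, G') \<in> ?P" using g by (auto simp: pair_orbit_def special_orthogonal_group_def)
    qed
    moreover have "?P \<union> ?Q \<subseteq> OA"
      using pair_orbit_subset_orbit_of_matrix[OF _ SO_sub] mem s_mem assms(7) by blast
    moreover have "?P \<in> pair_orbits special_orthogonal_group n" "?Q \<in> pair_orbits special_orthogonal_group n"
      using F(1,2) sF by (auto simp: pair_orbits_def)
    ultimately show "\<exists>P\<in>pair_orbits special_orthogonal_group n.
        \<exists>Q\<in>pair_orbits special_orthogonal_group n. P \<inter> Q = {} \<and> OA = P \<union> Q"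
      by blast
  qed
qed

end
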